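(* Let $F$ be a field, let $D$ be a division algebra with center $F$ and degree $d>2$, let $K|F$ be any splitting field of $D$, and regard $D$ as an $F$-subalgebra of $M_d(K)$ via a splitting representation, so that $D^\times\le \mathrm{GL}_d(K)$. Let $N\le \mathrm{GL}_d(K)$ be the subgroup of monomial matrices and $T\le N$ the subgroup of invertible diagonal matrices, and identify $N/T$ with the symmetric group $S_d$. Let $X$ be any coset in $N/T$ whose cycle decomposition features a unique cycle of minimum length that is not a $d$-cycle, where a $1$-cycle represents a fixed point. Let $z\in D^\times$ and $g\in\mathrm{GL}_d(K)$. Then $gzg^{-1}\notin X$.
   Context: A division algebra $D$ with center $F$ has degree $d$ if $\dim_F(D)=d^2$. A splitting field of $D$ is a field extension $K|F$ with $D\otimes_F K\cong M_d(K)$; a splitting representation is the resulting injective $F$-algebra homomorphism $D\hookrightarrow D\otimes_F K\cong M_d(K)$. A monomial matrix is one with exactly one nonzero entry in each row and column; the coset $nT$ of a monomial matrix $n$ corresponds to the permutation of $\{1,\dots,d\}$ given by the positions of the nonzero entries of $n$, which gives the identification $N/T\cong S_d$. Cycle decompositions include fixed points as $1$-cycles; the hypothesis on $X$ means that exactly one cycle in the decomposition has the minimum length $\ell$ among all cycles, and $\ell<d$. *)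

theory Defs
  imports
    "HOL-Algebra.QuotRing"
    "HOL-Library.Poly_Mapping"
    "HOL-Combinatorics.Orbits"
    "HOL-Combinatorics.Permutations"
    "Jordan_Normal_Form.Matrix"
begin

section \<open>Algebras over a field\<close>

text \<open>
  An associative unital algebra over a field, given by its scalar multiplication. A field
  extension is the special case in which the algebra is itself a field.
\<close>

locale field_algebra = vector_space scale
  for scale :: "'f::field \<Rightarrow> 'a::ring_1 \<Rightarrow> 'a" +
  assumes mult_scale_left: "scale a x * y = scale a (x * y)"
    and mult_scale_right: "x * scale a y = scale a (x * y)"

locale central_division_algebra = field_algebra scale
  for scale :: "'f::field \<Rightarrow> 'd::division_ring \<Rightarrow> 'd" +
  assumes center: "{x. \<forall>y. x * y = y * x} = range (\<lambda>a. scale a 1)"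

text \<open>
  The library's \<open>dim\<close> is \<open>0\<close> for infinite-dimensional spaces, so for \<open>d > 0\<close> the
  following forces finite dimension.
\<close>

definition has_degree :: "('f::field \<Rightarrow> 'd::division_ring \<Rightarrow> 'd) \<Rightarrow> nat \<Rightarrow> bool" where
  "has_degree scale d \<longleftrightarrow> vector_space.dim scale (UNIV :: 'd set) = d\<^sup>2"


section \<open>Tensor product of two algebras\<close>

text \<open>
  The free abelian group on the pairs \<open>(x, k)\<close>, made into a ring by extending
  \<open>(x, k) (y, l) = (x y, k l)\<close> bilinearly.
\<close>

definition pair_ring :: "(('d::ring_1 \<times> 'k::ring_1) \<Rightarrow>\<^sub>0 int) ring" where
  "pair_ring =
    \<lparr>carrier = UNIV,
     monoid.mult = (\<lambda>s t. frag_extend (\<lambda>(x, k). frag_extend (\<lambda>(y, l). frag_of (x * y, k * l)) t) s),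
     one = frag_of (1, 1),
     zero = 0,
     add = (+)\<rparr>"

definition tensor_relations ::
  "('f \<Rightarrow> 'd \<Rightarrow> 'd) \<Rightarrow> ('f \<Rightarrow> 'k \<Rightarrow> 'k) \<Rightarrow> (('d::ring_1 \<times> 'k::ring_1) \<Rightarrow>\<^sub>0 int) set" where
  "tensor_relations scaleD scaleK =
     {frag_of (x + y, k) - frag_of (x, k) - frag_of (y, k) | x y k. True} \<union>
     {frag_of (x, k + l) - frag_of (x, k) - frag_of (x, l) | x k l. True} \<union>
     {frag_of (scaleD a x, k) - frag_of (x, scaleK a k) | a x k. True}"

text \<open>
  For algebras, the additive subgroup spanned by the relations is stable under multiplication by
  pairs from either side. It is therefore the two-sided ideal generated by the relations, and the
  quotient ring below has the usual tensor product as its additive group.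
\<close>

definition tensor_ideal ::
  "('f \<Rightarrow> 'd \<Rightarrow> 'd) \<Rightarrow> ('f \<Rightarrow> 'k \<Rightarrow> 'k) \<Rightarrow> (('d::ring_1 \<times> 'k::ring_1) \<Rightarrow>\<^sub>0 int) set" where
  "tensor_ideal scaleD scaleK = Idl\<^bsub>pair_ring\<^esub> (tensor_relations scaleD scaleK)"

definition tensor_algebra ::
  "('f \<Rightarrow> 'd \<Rightarrow> 'd) \<Rightarrow> ('f \<Rightarrow> 'k \<Rightarrow> 'k) \<Rightarrow> (('d::ring_1 \<times> 'k::ring_1) \<Rightarrow>\<^sub>0 int) set ring" where
  "tensor_algebra scaleD scaleK = pair_ring Quot (tensor_ideal scaleD scaleK)"

definition pure_tensor ::
  "('f \<Rightarrow> 'd \<Rightarrow> 'd) \<Rightarrow> ('f \<Rightarrow> 'k \<Rightarrow> 'k) \<Rightarrow> 'd \<Rightarrow> 'k \<Rightarrow> (('d::ring_1 \<times> 'k::ring_1) \<Rightarrow>\<^sub>0 int) set" where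
  "pure_tensor scaleD scaleK x k = tensor_ideal scaleD scaleK +>\<^bsub>pair_ring\<^esub> frag_of (x, k)"


section \<open>Splitting fields and splitting representations\<close>

text \<open>
  Isomorphisms of \<open>K\<close>-algebras from \<open>D \<otimes>\<^sub>F K\<close> to \<open>M\<^sub>d(K)\<close>; the scalar \<open>c\<close> in \<open>K\<close> acts on the
  tensor product as multiplication by \<open>1 \<otimes> c\<close>.
\<close>

definition splitting_iso ::
  "('f \<Rightarrow> 'd \<Rightarrow> 'd) \<Rightarrow> ('f \<Rightarrow> 'k \<Rightarrow> 'k) \<Rightarrow> nat \<Rightarrow>
     ((('d::division_ring \<times> 'k::field) \<Rightarrow>\<^sub>0 int) set \<Rightarrow> 'k mat) \<Rightarrow> bool" where
  "splitting_iso scaleD scaleK d h \<longleftrightarrow>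
     h \<in> ring_iso (tensor_algebra scaleD scaleK) (ring_mat TYPE('k) d ()) \<and>
     (\<forall>c. \<forall>t \<in> carrier (tensor_algebra scaleD scaleK).
        h (pure_tensor scaleD scaleK 1 c \<otimes>\<^bsub>tensor_algebra scaleD scaleK\<^esub> t) = c \<cdot>\<^sub>m h t)"

definition splitting_field ::
  "('f::field \<Rightarrow> 'd::division_ring \<Rightarrow> 'd) \<Rightarrow> ('f \<Rightarrow> 'k::field \<Rightarrow> 'k) \<Rightarrow> nat \<Rightarrow> bool" where
  "splitting_field scaleD scaleK d \<longleftrightarrow>
     field_algebra scaleK \<and> (\<exists>h. splitting_iso scaleD scaleK d h)"

definition splitting_representation ::
  "('f \<Rightarrow> 'd::division_ring \<Rightarrow> 'd) \<Rightarrow> ('f \<Rightarrow> 'k::field \<Rightarrow> 'k) \<Rightarrow> nat \<Rightarrow> ('d \<Rightarrow> 'k mat) \<Rightarrow> bool" where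
  "splitting_representation scaleD scaleK d \<phi> \<longleftrightarrow>
     (\<exists>h. splitting_iso scaleD scaleK d h \<and> (\<forall>x. \<phi> x = h (pure_tensor scaleD scaleK x 1)))"


section \<open>Monomial matrices and their permutations\<close>

definition GL :: "nat \<Rightarrow> 'k::field mat monoid" where
  "GL d = units_of (ring_mat TYPE('k) d ())"

definition monomial_mat :: "nat \<Rightarrow> 'k::zero mat \<Rightarrow> bool" where
  "monomial_mat d A \<longleftrightarrow> A \<in> carrier_mat d d \<and>
     (\<forall>i<d. \<exists>!j. j < d \<and> A $$ (i, j) \<noteq> 0) \<and>
     (\<forall>j<d. \<exists>!i. i < d \<and> A $$ (i, j) \<noteq> 0)"

definition monomial_group :: "nat \<Rightarrow> 'k::field mat monoid" where
  "monomial_group d = (GL d)\<lparr>carrier := {A \<in> carrier (GL d). monomial_mat d A}\<rparr>"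

definition diagonal_subgroup :: "nat \<Rightarrow> 'k::field mat set" where
  "diagonal_subgroup d = {A \<in> carrier (GL d). diagonal_mat A}"

text \<open>
  The permutation of a coset of the diagonal subgroup: a matrix in the coset sends the line
  spanned by the \<open>j\<close>-th standard basis vector to that spanned by the \<open>p j\<close>-th one. Indices run
  over \<open>{..<d}\<close> instead of \<open>{1..d}\<close>.
\<close>

definition coset_permutation :: "nat \<Rightarrow> 'k::field mat set \<Rightarrow> (nat \<Rightarrow> nat) \<Rightarrow> bool" where
  "coset_permutation d X p \<longleftrightarrow> p permutes {..<d} \<and>
     (\<forall>A \<in> X. \<forall>i<d. \<forall>j<d. A $$ (i, j) \<noteq> 0 \<longleftrightarrow> i = p j)"

text \<open>
  The cycles in the cycle decomposition, each given by the set of points it moves around; a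
  fixed point contributes a singleton.
\<close>

definition perm_cycles :: "nat \<Rightarrow> (nat \<Rightarrow> nat) \<Rightarrow> nat set set" where
  "perm_cycles d p = orbit p ` {..<d}"

definition unique_shortest_cycle :: "nat \<Rightarrow> (nat \<Rightarrow> nat) \<Rightarrow> bool" where
  "unique_shortest_cycle d p \<longleftrightarrow>
     (let l = Min (card ` perm_cycles d p)
      in l < d \<and> (\<exists>!C. C \<in> perm_cycles d p \<and> card C = l))"

end

theory Submission
  imports Defs "Jordan_Normal_Form.Char_Poly"
begin

text \<open>
  Suppose that \<open>A = g \<phi>(z) g\<^sup>-\<^sup>1\<close> is monomial with permutation \<open>p\<close>, let \<open>x\<close> be a point of the unique
  shortest cycle and \<open>l\<close> the length of that cycle. Row and column \<open>x\<close> of \<open>A\<^sup>l\<close> vanish off the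
  diagonal; let \<open>a\<close> be the diagonal entry. Assume for the moment that \<open>a\<close> lies in \<open>F\<close>. Then the
  matrix of \<open>z\<^sup>l - a\<close> has a zero column, so \<open>z\<^sup>l - a\<close> is not invertible and must vanish in the
  division algebra. Hence \<open>A\<^sup>l\<close> is a scalar matrix, so every cycle of \<open>p\<close> has length at most \<open>l\<close>,
  and by uniqueness \<open>p\<close> is a single cycle of length \<open>d\<close>, contrary to \<open>l < d\<close>.

  The point is therefore that \<open>a \<in> F\<close>. The regular representation of \<open>D\<close> over \<open>F\<close> becomes, over \<open>K\<close>,
  a sum of \<open>d\<close> copies of \<open>\<phi>\<close>, so the \<open>d\<close>-th power of the characteristic polynomial \<open>\<chi>\<close> of \<open>A\<close> has
  coefficients in \<open>F\<close> (\<open>char_poly_rep_power\<close>). Since the shortest cycle is unique,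
  \<open>\<chi> = X\<^sup>d \<plusminus> a X\<^bsup>d-l\<^esup> +\<close> lower terms (\<open>coeff_char_poly_shortest_cycle\<close>). Comparing coefficients in
  \<open>\<chi>\<^sup>d\<close> yields \<open>a \<in> F\<close> if the characteristic does not divide \<open>d\<close>. In general, in characteristic
  \<open>r > 0\<close>, it yields \<open>a\<^sup>q \<in> F\<close> for some power \<open>q\<close> of \<open>r\<close> (\<open>second_coeff_inseparable_of_power\<close>).

  The exponent \<open>q\<close> is removed by a commutator argument (\<open>scalar_if_inseparable_eigenvalue\<close>). By
  induction on \<open>q\<close> it suffices to treat \<open>w \<in> D\<close> such that \<open>w\<^sup>r\<close> is central and such that row and column
  \<open>x\<close> of the matrix of \<open>w\<close> vanish off the diagonal. If \<open>w\<close> were not central, the derivation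
  \<open>y \<mapsto> w y - y w\<close> would be nonzero and nilpotent, and the division algebra would contain \<open>t\<close> with
  \<open>w t - t w = 1\<close> (\<open>exists_commutator_one\<close>). But the diagonal entry at \<open>x\<close> of a commutator with such a
  matrix is \<open>0\<close>.
\<close>

section \<open>Matrices\<close>

lemma index_mult_mat_sum:
  fixes A :: "'a::semiring_0 mat"
  assumes "A \<in> carrier_mat m k" "B \<in> carrier_mat k n" "i < m" "j < n"
  shows "(A * B) $$ (i, j) = (\<Sum>l<k. A $$ (i, l) * B $$ (l, j))"
  using assms by (auto simp: scalar_prod_def lessThan_atLeast0 intro!: sum.cong)

lemma zero_matI_add_self:
  fixes A :: "'a::ab_group_add mat"
  assumes "A \<in> carrier_mat m n" and "A = A + A"
  shows "A = 0\<^sub>m m n"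
proof (rule eq_matI)
  fix i j assume "i < dim_row (0\<^sub>m m n :: 'a mat)" "j < dim_col (0\<^sub>m m n :: 'a mat)"
  then show "A $$ (i, j) = 0\<^sub>m m n $$ (i, j)"
    using arg_cong[OF assms(2), of "\<lambda>M. M $$ (i, j)"] assms(1) by simp
qed (use assms in auto)

lemma minus_eq_if_add_eq_mat:
  fixes A :: "'a::ab_group_add mat"
  assumes "A \<in> carrier_mat m n" "B \<in> carrier_mat m n" and "C = A + B"
  shows "A = C - B"
  using assms by (intro eq_matI) auto

lemma eq_if_minus_eq_zero_mat:
  fixes A :: "'a::ab_group_add mat"
  assumes "A \<in> carrier_mat m n" "B \<in> carrier_mat m n" and "A - B = 0\<^sub>m m n"
  shows "A = B"
proof (rule eq_matI)
  fix i j assume "i < dim_row B" "j < dim_col B"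
  then show "A $$ (i, j) = B $$ (i, j)"
    using arg_cong[OF assms(3), of "\<lambda>M. M $$ (i, j)"] assms(1,2) by simp
qed (use assms in auto)

text \<open>
  The basis vector with index \<open>j\<close> spans a direct summand, of dimension one, on which \<open>M\<close> acts as the
  scalar \<open>a\<close>. Knowing the row as well as the column makes the entry at \<open>(j, j)\<close> of a product with
  \<open>M\<close>, on either side, computable; this is what the commutator argument needs.
\<close>

definition isolated_index :: "'a::zero mat \<Rightarrow> nat \<Rightarrow> 'a \<Rightarrow> bool" where
  "isolated_index M j a \<longleftrightarrow> j < dim_row M \<and> j < dim_col M \<and> M $$ (j, j) = a \<and>
     (\<forall>i<dim_row M. i \<noteq> j \<longrightarrow> M $$ (i, j) = 0) \<and> (\<forall>i<dim_col M. i \<noteq> j \<longrightarrow> M $$ (j, i) = 0)"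

lemma isolated_index_mult_left:
  fixes M N :: "'a::semiring_0 mat"
  assumes M: "M \<in> carrier_mat n n" and N: "N \<in> carrier_mat n n"
    and iso: "isolated_index M j a" and i: "i < n"
  shows "(M * N) $$ (j, i) = a * N $$ (j, i)"
proof -
  have j: "j < n" using iso M by (simp add: isolated_index_def)
  have "(M * N) $$ (j, i) = (\<Sum>l<n. M $$ (j, l) * N $$ (l, i))"
    by (rule index_mult_mat_sum[OF M N j i])
  also have "\<dots> = (\<Sum>l\<in>{j}. M $$ (j, l) * N $$ (l, i))"
    using iso M j by (intro sum.mono_neutral_right) (auto simp: isolated_index_def)
  finally show ?thesis using iso by (simp add: isolated_index_def)
qed

lemma isolated_index_mult_right:
  fixes M N :: "'a::semiring_0 mat"
  assumes M: "M \<in> carrier_mat n n" and N: "N \<in> carrier_mat n n"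
    and iso: "isolated_index M j a" and i: "i < n"
  shows "(N * M) $$ (i, j) = N $$ (i, j) * a"
proof -
  have j: "j < n" using iso M by (simp add: isolated_index_def)
  have "(N * M) $$ (i, j) = (\<Sum>l<n. N $$ (i, l) * M $$ (l, j))"
    by (rule index_mult_mat_sum[OF N M i j])
  also have "\<dots> = (\<Sum>l\<in>{j}. N $$ (i, l) * M $$ (l, j))"
    using iso M j by (intro sum.mono_neutral_right) (auto simp: isolated_index_def)
  finally show ?thesis using iso by (simp add: isolated_index_def)
qed

lemma isolated_index_mult:
  fixes M N :: "'a::semiring_0 mat"
  assumes M: "M \<in> carrier_mat n n" and N: "N \<in> carrier_mat n n"
    and iso: "isolated_index M j a" "isolated_index N j b"
  shows "isolated_index (M * N) j (a * b)"
proof -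
  have j: "j < n" using iso M by (simp add: isolated_index_def)
  show ?thesis
    unfolding isolated_index_def
    using isolated_index_mult_left[OF M N iso(1)] isolated_index_mult_right[OF N M iso(2)]
      iso M N j by (auto simp: isolated_index_def)
qed

lemma isolated_index_power:
  fixes M :: "'a::semiring_1 mat"
  assumes M: "M \<in> carrier_mat n n" and iso: "isolated_index M j a"
  shows "isolated_index (M ^\<^sub>m k) j (a ^ k)"
proof (induction k)
  case 0
  then show ?case using M iso by (auto simp: isolated_index_def)
next
  case (Suc k)
  have "isolated_index (M ^\<^sub>m k * M) j (a ^ k * a)"
    using Suc iso M by (intro isolated_index_mult[of _ n]) auto
  then show ?case by (simp add: power_Suc2 del: power_Suc)
qed

lemma char_poly_four_block_diag:
  fixes A B :: "'a::idom mat"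
  assumes A: "A \<in> carrier_mat n n" and B: "B \<in> carrier_mat m m"
  shows "char_poly (four_block_mat A (0\<^sub>m n m) (0\<^sub>m m n) B) = char_poly A * char_poly B"
proof -
  have "char_poly_matrix (four_block_mat A (0\<^sub>m n m) (0\<^sub>m m n) B)
      = four_block_mat (char_poly_matrix A) (0\<^sub>m n m) (0\<^sub>m m n) (char_poly_matrix B)"
    using A B by (intro eq_matI) (auto simp: char_poly_matrix_def)
  then show ?thesis
    using A B by (simp add: char_poly_def det_four_block_mat_lower_left_zero[of _ n _ m])
qed

lemma char_poly_diag_block_replicate:
  fixes A :: "'a::idom mat"
  assumes A: "A \<in> carrier_mat n n"
  shows "char_poly (diag_block_mat (replicate m A)) = char_poly A ^ m"
proof (induction m)
  case 0
  have "char_poly_matrix (0\<^sub>m 0 0 :: 'a mat) = 1\<^sub>m 0" by (intro eq_matI) (auto simp: char_poly_matrix_def)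
  then show ?case by (simp add: char_poly_def)
next
  case (Suc m)
  have "diag_block_mat (replicate m A) \<in> carrier_mat (m * n) (m * n)"
    using A by (auto intro!: carrier_matI simp: dim_diag_block_mat sum_list_replicate)
  then show ?case
    using A Suc char_poly_four_block_diag[OF A] by (simp add: Let_def)
qed

lemma index_diag_block_replicate:
  assumes A: "A \<in> carrier_mat n n" and "i < m * n" "j < m * n"
  shows "diag_block_mat (replicate m A) $$ (i, j)
    = (if i div n = j div n then A $$ (i mod n, j mod n) else 0)"
  using assms(2,3)
proof (induction m arbitrary: i j)
  case (Suc m)
  have dims: "dim_row (diag_block_mat (replicate m A)) = m * n"
    "dim_col (diag_block_mat (replicate m A)) = m * n"
    using A by (auto simp: dim_diag_block_mat sum_list_replicate)
  have shift: "k div n = Suc ((k - n) div n)" "k mod n = (k - n) mod n" if "n \<le> k" "0 < n" for k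
    using that by (simp_all add: le_div_geq le_mod_geq)
  have n: "0 < n" using Suc.prems by (cases n) auto
  show ?case
    using Suc A n shift[of i] shift[of j] by (auto simp: Let_def dims not_less)
qed simp

section \<open>Representations of a central division algebra\<close>

text \<open>
  A representation over an extension field that need not come from a splitting: the argument uses it
  for the conjugates of a splitting representation as well.
\<close>

locale algebra_representation = central_division_algebra scaleD + iota: field_hom \<iota>
  for scaleD :: "'f::field \<Rightarrow> 'd::division_ring \<Rightarrow> 'd" and \<iota> :: "'f \<Rightarrow> 'k::field" +
  fixes d :: nat and \<phi> :: "'d \<Rightarrow> 'k mat"
  assumes rep_carrier [simp]: "\<phi> x \<in> carrier_mat d d"
    and rep_add: "\<phi> (x + y) = \<phi> x + \<phi> y"
    and rep_mult: "\<phi> (x * y) = \<phi> x * \<phi> y"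
    and rep_one: "\<phi> 1 = 1\<^sub>m d"
    and rep_scale: "\<phi> (scaleD r x) = \<iota> r \<cdot>\<^sub>m \<phi> x"
begin

lemma rep_dim [simp]: "dim_row (\<phi> x) = d" "dim_col (\<phi> x) = d"
  using carrier_matD[OF rep_carrier[of x]] by simp_all

lemma rep_zero: "\<phi> 0 = 0\<^sub>m d d"
  using rep_add[of 0 0] by (intro zero_matI_add_self) simp_all

lemma rep_diff: "\<phi> (x - y) = \<phi> x - \<phi> y"
  using rep_add[of "x - y" y] by (intro minus_eq_if_add_eq_mat[of _ d d]) simp_all

lemma rep_power: "\<phi> (x ^ n) = \<phi> x ^\<^sub>m n"
  by (induction n) (simp_all add: rep_one rep_mult power_Suc2 del: power_Suc)

lemma index_rep_linear_combination:
  assumes "finite B" "i < d" "j < d"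
  shows "\<phi> (\<Sum>b\<in>B. scaleD (r b) b) $$ (i, j) = (\<Sum>b\<in>B. \<iota> (r b) * \<phi> b $$ (i, j))"
  using assms(1)
proof induction
  case empty
  then show ?case using assms by (simp add: rep_zero)
next
  case (insert b B)
  then show ?case using assms by (simp add: rep_add rep_scale)
qed

lemma rep_conjugate:
  assumes "P \<in> carrier_mat d d" "Q \<in> carrier_mat d d" "P * Q = 1\<^sub>m d" "Q * P = 1\<^sub>m d"
  shows "algebra_representation scaleD \<iota> d (\<lambda>x. P * \<phi> x * Q)"
proof unfold_locales
  note [simp] = assms(1,2)
  have PX [simp]: "P * \<phi> x \<in> carrier_mat d d" for x
    by (rule mult_carrier_mat[OF assms(1) rep_carrier])
  show "P * \<phi> x * Q \<in> carrier_mat d d" for x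
    by (rule mult_carrier_mat[OF PX assms(2)])
  show "P * \<phi> (x + y) * Q = P * \<phi> x * Q + P * \<phi> y * Q" for x y
    by (simp add: rep_add mult_add_distrib_mat[OF assms(1) rep_carrier rep_carrier]
        add_mult_distrib_mat[OF PX PX assms(2)])
  show "P * \<phi> (x * y) * Q = P * \<phi> x * Q * (P * \<phi> y * Q)" for x y
  proof -
    have "P * \<phi> x * Q * (P * \<phi> y * Q) = P * \<phi> x * (Q * (P * \<phi> y * Q))"
      by (rule assoc_mult_mat[OF PX assms(2) mult_carrier_mat[OF PX assms(2)]])
    also have "Q * (P * \<phi> y * Q) = Q * (P * \<phi> y) * Q"
      by (rule assoc_mult_mat[OF assms(2) PX assms(2), symmetric])
    also have "Q * (P * \<phi> y) = \<phi> y"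
      using assoc_mult_mat[OF assms(2,1) rep_carrier, of y] assms(4) left_mult_one_mat[OF rep_carrier, of y] by simp
    also have "P * \<phi> x * (\<phi> y * Q) = P * \<phi> x * \<phi> y * Q"
      by (rule assoc_mult_mat[OF PX rep_carrier assms(2), symmetric])
    also have "P * \<phi> x * \<phi> y = P * (\<phi> x * \<phi> y)"
      by (rule assoc_mult_mat[OF assms(1) rep_carrier rep_carrier])
    finally show ?thesis by (simp add: rep_mult)
  qed
  show "P * \<phi> 1 * Q = 1\<^sub>m d" using right_mult_one_mat[OF assms(1)] assms(3) by (simp add: rep_one)
  show "P * \<phi> (scaleD r x) * Q = \<iota> r \<cdot>\<^sub>m (P * \<phi> x * Q)" for r x
    by (simp add: rep_scale mult_smult_distrib[OF assms(1) rep_carrier] mult_smult_assoc_mat[OF PX assms(2)])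
qed

lemma central_iff_scalar: "(\<forall>y. x * y = y * x) \<longleftrightarrow> (\<exists>r. x = scaleD r 1)"
  using center by (auto simp: set_eq_iff)

text \<open>
  A nonzero element is invertible, and a matrix with a zero column is not.
\<close>

lemma eq_zero_if_column_zero:
  assumes j: "j < d" and zero: "\<And>i. i < d \<Longrightarrow> \<phi> x $$ (i, j) = 0"
  shows "x = 0"
proof (rule ccontr)
  assume "x \<noteq> 0"
  then have "\<phi> (inverse x) * \<phi> x = 1\<^sub>m d" by (simp flip: rep_mult add: rep_one)
  moreover have "(\<phi> (inverse x) * \<phi> x) $$ (j, j) = 0"
    unfolding index_mult_mat_sum[OF rep_carrier rep_carrier j j] using zero by (intro sum.neutral) auto
  ultimately show False using j by simp
qed

lemma index_rep_scale_one: "i < d \<Longrightarrow> j < d \<Longrightarrow> \<phi> (scaleD r 1) $$ (i, j) = (if i = j then \<iota> r else 0)"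
  by (simp add: rep_scale rep_one)

lemma eq_scale_if_rational_eigenvalue:
  assumes iso: "isolated_index (\<phi> x) j (\<iota> r)"
  shows "x = scaleD r 1"
proof -
  have j: "j < d" using iso by (simp add: isolated_index_def)
  have "x - scaleD r 1 = 0"
    using iso j by (intro eq_zero_if_column_zero[OF j])
      (auto simp: rep_diff index_rep_scale_one isolated_index_def)
  then show ?thesis by simp
qed

end

text \<open>
  What the proof uses of the splitting isomorphism: \<open>K\<close>-linear combinations of the images of
  an \<open>F\<close>-basis give all matrices. When the basis has \<open>d\<^sup>2\<close> elements, it follows that the images form
  a \<open>K\<close>-basis of the matrix algebra.
\<close>

locale split_representation = algebra_representation scaleD \<iota> d \<phi>
  for scaleD :: "'f::field \<Rightarrow> 'd::division_ring \<Rightarrow> 'd" and \<iota> :: "'f \<Rightarrow> 'k::field"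
    and d :: nat and \<phi> :: "'d \<Rightarrow> 'k mat" +
  assumes rep_span: "finite B \<Longrightarrow> span B = UNIV \<Longrightarrow> M \<in> carrier_mat d d \<Longrightarrow>
      \<exists>c. \<forall>i<d. \<forall>j<d. M $$ (i, j) = (\<Sum>b\<in>B. c b * \<phi> b $$ (i, j))"

section \<open>The tensor product and splitting representations\<close>

lemma mult_pair_ring:
  "s \<otimes>\<^bsub>pair_ring\<^esub> t = frag_extend (\<lambda>(x, k). frag_extend (\<lambda>(y, l). frag_of (x * y, k * l)) t) s"
  by (simp add: pair_ring_def)

lemma mult_pair_ring_diff_left:
  "(s - t) \<otimes>\<^bsub>pair_ring\<^esub> u = s \<otimes>\<^bsub>pair_ring\<^esub> u - t \<otimes>\<^bsub>pair_ring\<^esub> u"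
  by (simp add: mult_pair_ring frag_extend_diff)

lemma mult_pair_ring_diff_right:
  "s \<otimes>\<^bsub>pair_ring\<^esub> (t - u) = s \<otimes>\<^bsub>pair_ring\<^esub> t - s \<otimes>\<^bsub>pair_ring\<^esub> u"
proof -
  have "Poly_Mapping.keys s \<subseteq> UNIV" by simp
  then show ?thesis
    by (induction s rule: frag_induction)
      (auto simp: mult_pair_ring_diff_left, auto simp: mult_pair_ring frag_extend_diff)
qed

lemma mult_pair_ring_zero [simp]: "0 \<otimes>\<^bsub>pair_ring\<^esub> s = 0" "s \<otimes>\<^bsub>pair_ring\<^esub> 0 = 0"
  using mult_pair_ring_diff_left[of 0 0 s] mult_pair_ring_diff_right[of s 0 0] by simp_all

lemma mult_pair_ring_of [simp]:
  "frag_of (x, k) \<otimes>\<^bsub>pair_ring\<^esub> frag_of (y, l) = frag_of (x * y, k * l)"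
  by (simp add: mult_pair_ring)

lemma mult_pair_ring_assoc:
  "(s \<otimes>\<^bsub>pair_ring\<^esub> t) \<otimes>\<^bsub>pair_ring\<^esub> u = s \<otimes>\<^bsub>pair_ring\<^esub> (t \<otimes>\<^bsub>pair_ring\<^esub> u)"
proof -
  have s: "Poly_Mapping.keys s \<subseteq> UNIV" and t: "Poly_Mapping.keys t \<subseteq> UNIV"
    and u: "Poly_Mapping.keys u \<subseteq> UNIV" by simp_all
  have "(frag_of a \<otimes>\<^bsub>pair_ring\<^esub> frag_of b) \<otimes>\<^bsub>pair_ring\<^esub> u
      = frag_of a \<otimes>\<^bsub>pair_ring\<^esub> (frag_of b \<otimes>\<^bsub>pair_ring\<^esub> u)" for a b
    using u by (induction u rule: frag_induction; cases a; cases b)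
      (auto simp: mult_pair_ring_diff_right mult.assoc)
  note of_of = this
  have "(frag_of a \<otimes>\<^bsub>pair_ring\<^esub> t) \<otimes>\<^bsub>pair_ring\<^esub> u
      = frag_of a \<otimes>\<^bsub>pair_ring\<^esub> (t \<otimes>\<^bsub>pair_ring\<^esub> u)" for a
    using t by (induction t rule: frag_induction)
      (auto simp: of_of mult_pair_ring_diff_right mult_pair_ring_diff_left)
  note of_any = this
  show ?thesis
    using s by (induction s rule: frag_induction) (auto simp: of_any mult_pair_ring_diff_left)
qed

lemma mult_pair_ring_one:
  "frag_of (1, 1) \<otimes>\<^bsub>pair_ring\<^esub> s = s" "s \<otimes>\<^bsub>pair_ring\<^esub> frag_of (1, 1) = s"
proof -
  have s: "Poly_Mapping.keys s \<subseteq> UNIV" by simp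
  show "frag_of (1, 1) \<otimes>\<^bsub>pair_ring\<^esub> s = s"
    using s by (induction s rule: frag_induction) (auto simp: mult_pair_ring_diff_right)
  show "s \<otimes>\<^bsub>pair_ring\<^esub> frag_of (1, 1) = s"
    using s by (induction s rule: frag_induction) (auto simp: mult_pair_ring_diff_left)
qed

lemma ring_pair_ring: "ring (pair_ring :: (('a::ring_1 \<times> 'b::ring_1) \<Rightarrow>\<^sub>0 int) ring)"
  (is "ring ?R")
proof (rule ringI)
  show "abelian_group ?R"
  proof (rule abelian_groupI)
    show "\<exists>t\<in>carrier ?R. t \<oplus>\<^bsub>?R\<^esub> s = \<zero>\<^bsub>?R\<^esub>"
      for s :: "('a \<times> 'b) \<Rightarrow>\<^sub>0 int"
      by (intro bexI[of _ "- s"]) (simp_all add: pair_ring_def)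
  qed (simp_all add: pair_ring_def add_ac)
  show "monoid ?R"
  proof (rule monoidI)
    show "\<one>\<^bsub>?R\<^esub> \<otimes>\<^bsub>?R\<^esub> s = s" "s \<otimes>\<^bsub>?R\<^esub> \<one>\<^bsub>?R\<^esub> = s" for s
      using mult_pair_ring_one[of s] by (simp_all add: pair_ring_def)
  qed (simp_all add: mult_pair_ring_assoc, simp_all add: pair_ring_def)
  fix s t u :: "('a \<times> 'b) \<Rightarrow>\<^sub>0 int"
  have add: "a \<oplus>\<^bsub>?R\<^esub> b = a - (0 - b)" for a b :: "('a \<times> 'b) \<Rightarrow>\<^sub>0 int"
    by (simp add: pair_ring_def)
  show "(s \<oplus>\<^bsub>?R\<^esub> t) \<otimes>\<^bsub>?R\<^esub> u = s \<otimes>\<^bsub>?R\<^esub> u \<oplus>\<^bsub>?R\<^esub> t \<otimes>\<^bsub>?R\<^esub> u"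
    unfolding add mult_pair_ring_diff_left by simp
  show "u \<otimes>\<^bsub>?R\<^esub> (s \<oplus>\<^bsub>?R\<^esub> t) = u \<otimes>\<^bsub>?R\<^esub> s \<oplus>\<^bsub>?R\<^esub> u \<otimes>\<^bsub>?R\<^esub> t"
    unfolding add mult_pair_ring_diff_right by simp
qed

lemma field_hom_scale_one:
  fixes scaleK :: "'f::field \<Rightarrow> 'k::field \<Rightarrow> 'k"
  assumes "field_algebra scaleK"
  shows "field_hom (\<lambda>r. scaleK r 1)"
proof -
  interpret field_algebra scaleK by fact
  show ?thesis
    by unfold_locales (simp_all add: scale_left_distrib mult_scale_left)
qed

text \<open>
  Lifting the splitting isomorphism to the free abelian group on pairs turns each property of the
  tensor product into an equation between matrices: an element of the free group is a difference of
  sums of pairs, and the pair \<open>(x, c)\<close> goes to \<open>c \<phi>(x)\<close>. That is why the images of a basis span.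
\<close>

lemma split_representationI:
  fixes scaleD :: "'f::field \<Rightarrow> 'd::division_ring \<Rightarrow> 'd" and scaleK :: "'f \<Rightarrow> 'k::field \<Rightarrow> 'k"
  assumes D: "central_division_algebra scaleD" and K: "field_algebra scaleK"
    and \<phi>: "splitting_representation scaleD scaleK d \<phi>"
  shows "split_representation scaleD (\<lambda>r. scaleK r 1) d \<phi>"
proof -
  interpret D: central_division_algebra scaleD by fact
  interpret K: field_algebra scaleK by fact
  interpret P: ring "pair_ring :: (('d \<times> 'k) \<Rightarrow>\<^sub>0 int) ring" by (rule ring_pair_ring)
  define I where "I = tensor_ideal scaleD scaleK"
  have rel_carrier: "tensor_relations scaleD scaleK \<subseteq> carrier pair_ring"
    by (simp add: pair_ring_def)
  interpret I: ideal I pair_ring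
    unfolding I_def tensor_ideal_def using rel_carrier by (rule P.genideal_ideal)
  have rel_I: "tensor_relations scaleD scaleK \<subseteq> I"
    unfolding I_def tensor_ideal_def using rel_carrier by (rule P.genideal_self)
  from \<phi> obtain h where h: "splitting_iso scaleD scaleK d h"
    and \<phi>_h: "\<And>x. \<phi> x = h (pure_tensor scaleD scaleK x 1)"
    unfolding splitting_representation_def by blast
  define H where "H s = h (I +>\<^bsub>pair_ring\<^esub> s)" for s
  have T: "tensor_algebra scaleD scaleK = pair_ring Quot I"
    by (simp add: tensor_algebra_def I_def)
  have h_iso: "h \<in> ring_iso (pair_ring Quot I) (ring_mat TYPE('k) d ())"
    using h by (simp add: splitting_iso_def T)
  have rcos: "(+>\<^bsub>pair_ring\<^esub>) I \<in> Ring.ring_hom pair_ring (pair_ring Quot I)"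
    by (rule I.rcos_ring_hom)
  have "h \<circ> (+>\<^bsub>pair_ring\<^esub>) I \<in> Ring.ring_hom pair_ring (ring_mat TYPE('k) d ())"
    by (rule ring_hom_trans[OF rcos]) (use h_iso in \<open>simp add: ring_iso_def\<close>)
  then have H_hom: "H \<in> Ring.ring_hom pair_ring (ring_mat TYPE('k) d ())"
    by (simp add: H_def[abs_def] o_def)
  have carrier [simp]: "s \<in> carrier pair_ring" for s :: "('d \<times> 'k) \<Rightarrow>\<^sub>0 int"
    by (simp add: pair_ring_def)
  have H_carrier [simp]: "H s \<in> carrier_mat d d" for s
    using ring_hom_closed[OF H_hom, of s] by (simp add: ring_mat_def)
  have H_add: "H (s + t) = H s + H t" for s t
    using ring_hom_add[OF H_hom, of s t] by (simp add: ring_mat_def pair_ring_def)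
  have H_mult: "H (s \<otimes>\<^bsub>pair_ring\<^esub> t) = H s * H t" for s t
    using ring_hom_mult[OF H_hom, of s t] by (simp add: ring_mat_def)
  have H_one: "H (frag_of (1, 1)) = 1\<^sub>m d"
    using ring_hom_one[OF H_hom] by (simp add: ring_mat_def pair_ring_def)
  have H_zero: "H 0 = 0\<^sub>m d d"
    using H_add[of 0 0] by (intro zero_matI_add_self) simp_all
  have H_diff: "H (s - t) = H s - H t" for s t
    using H_add[of "s - t" t] by (intro minus_eq_if_add_eq_mat[of _ d d]) simp_all
  have H_eq: "H s = H t" if "s - t \<in> tensor_relations scaleD scaleK" for s t
  proof -
    have "I +>\<^bsub>pair_ring\<^esub> (s - t) = I +>\<^bsub>pair_ring\<^esub> 0"
      using that rel_I I.a_rcos_const[of "s - t"] I.a_rcos_const[of "0"] I.zero_closed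
      by (auto simp: pair_ring_def)
    then have "H s - H t = 0\<^sub>m d d" using H_diff[of s t] H_zero by (simp add: H_def)
    then show ?thesis
      by (rule eq_if_minus_eq_zero_mat[OF H_carrier H_carrier])
  qed
  have H_scale: "H (frag_of (1, c) \<otimes>\<^bsub>pair_ring\<^esub> s) = c \<cdot>\<^sub>m H s" for c s
  proof -
    have "h ((I +>\<^bsub>pair_ring\<^esub> frag_of (1, c)) \<otimes>\<^bsub>pair_ring Quot I\<^esub> (I +>\<^bsub>pair_ring\<^esub> s)) = c \<cdot>\<^sub>m h (I +>\<^bsub>pair_ring\<^esub> s)"
      using h ring_hom_closed[OF rcos, of s] by (simp add: splitting_iso_def T pure_tensor_def I_def)
    then show ?thesis
      using ring_hom_mult[OF rcos, of "frag_of (1, c)" s] by (simp add: H_def)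
  qed
  have H_surj: "\<exists>s. M = H s" if "M \<in> carrier_mat d d" for M
  proof -
    have "h ` carrier (pair_ring Quot I) = carrier_mat d d"
      using h_iso by (simp add: ring_iso_def bij_betw_def ring_mat_def)
    with that have "M \<in> h ` carrier (pair_ring Quot I)" by simp
    then obtain t where "M = h t" and "t \<in> carrier (pair_ring Quot I)" by (elim imageE)
    then show ?thesis by (auto simp: H_def FactRing_def A_RCOSETS_def')
  qed
  have \<phi>_H: "\<phi> x = H (frag_of (x, 1))" for x
    by (simp add: \<phi>_h H_def I_def pure_tensor_def)
  have H_pair: "H (frag_of (x, c)) = c \<cdot>\<^sub>m \<phi> x" for x c
    using H_scale[of c "frag_of (x, 1)"] by (simp add: \<phi>_H)
  have \<phi>_carrier [simp]: "\<phi> x \<in> carrier_mat d d" for x by (simp add: \<phi>_H)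
  have \<phi>_dim [simp]: "dim_row (\<phi> x) = d" "dim_col (\<phi> x) = d" for x
    using carrier_matD[OF \<phi>_carrier[of x]] by simp_all
  have H_dim [simp]: "dim_row (H s) = d" "dim_col (H s) = d" for s
    using carrier_matD[OF H_carrier[of s]] by simp_all
  have \<phi>_scale: "\<phi> (scaleD r x) = scaleK r 1 \<cdot>\<^sub>m \<phi> x" for r x
  proof -
    have "H (frag_of (scaleD r x, 1)) = H (frag_of (x, scaleK r 1))"
      by (rule H_eq) (unfold tensor_relations_def, blast)
    then show ?thesis using H_pair[of x "scaleK r 1"] by (simp add: \<phi>_H[of "scaleD r x"])
  qed
  have \<phi>_add: "\<phi> (x + y) = \<phi> x + \<phi> y" for x y
  proof -
    have "H (frag_of (x + y, 1)) = H (frag_of (x, 1) + frag_of (y, 1))"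
      by (rule H_eq) (unfold tensor_relations_def diff_diff_eq[symmetric], blast)
    then show ?thesis by (simp add: \<phi>_H H_add)
  qed
  interpret iota: field_hom "\<lambda>r. scaleK r 1" by (rule field_hom_scale_one[OF K])
  interpret algebra_representation scaleD "\<lambda>r. scaleK r 1" d \<phi>
  proof unfold_locales
    show "\<phi> (x * y) = \<phi> x * \<phi> y" for x y
      using H_mult[of "frag_of (x, 1)" "frag_of (y, 1)"] by (simp add: \<phi>_H)
    show "\<phi> 1 = 1\<^sub>m d" by (simp add: \<phi>_H H_one)
  qed (simp_all add: \<phi>_add \<phi>_scale)
  show ?thesis
  proof unfold_locales
    fix B :: "'d set" and M :: "'k mat"
    assume B: "finite B" "D.span B = UNIV" and M: "M \<in> carrier_mat d d"
    have "\<exists>c. \<forall>i<d. \<forall>j<d. H s $$ (i, j) = (\<Sum>b\<in>B. c b * \<phi> b $$ (i, j))" for s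
      using subset_UNIV[of "Poly_Mapping.keys s"]
    proof (induction s rule: frag_induction)
      case zero
      then show ?case by (intro exI[of _ "\<lambda>_. 0"]) (simp add: H_zero)
    next
      case (one a)
      obtain x k where a: "a = (x, k)" by (cases a)
      obtain r where r: "x = (\<Sum>b\<in>B. scaleD (r b) b)"
        using D.span_finite[OF B(1)] B(2) by blast
      have "H (frag_of a) $$ (i, j) = (\<Sum>b\<in>B. k * scaleK (r b) 1 * \<phi> b $$ (i, j))"
        if "i < d" "j < d" for i j
        using that index_rep_linear_combination[OF B(1) that, of r]
        by (simp add: a H_pair flip: r) (simp add: sum_distrib_left mult.assoc)
      then show ?case by (intro exI[of _ "\<lambda>b. k * scaleK (r b) 1"]) blast
    next
      case (diff s t)
      obtain c where c: "\<forall>i<d. \<forall>j<d. H s $$ (i, j) = (\<Sum>b\<in>B. c b * \<phi> b $$ (i, j))"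
        using diff(1) by (elim exE)
      obtain e where e: "\<forall>i<d. \<forall>j<d. H t $$ (i, j) = (\<Sum>b\<in>B. e b * \<phi> b $$ (i, j))"
        using diff(2) by (elim exE)
      show ?case
        by (intro exI[of _ "\<lambda>b. c b - e b"]) (simp add: c e H_diff sum_subtractf left_diff_distrib)
    qed
    moreover obtain s where "M = H s" using H_surj[OF M] by (elim exE)
    ultimately show "\<exists>c. \<forall>i<d. \<forall>j<d. M $$ (i, j) = (\<Sum>b\<in>B. c b * \<phi> b $$ (i, j))" by simp
  qed
qed

section \<open>The characteristic polynomial and the centre\<close>

context split_representation
begin

text \<open>
  Let \<open>L\<close> be the matrix over \<open>F\<close> of left multiplication by \<open>z\<close> on the division algebra. Extending the
  scalars to \<open>K\<close> turns left multiplication by \<open>z\<close> into left multiplication by \<open>\<phi>(z)\<close> on the matrix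
  algebra, which acts on each of the \<open>d\<close> columns separately. So over \<open>K\<close> the matrix \<open>L\<close> is similar to
  a block diagonal matrix with \<open>d\<close> blocks \<open>\<phi>(z)\<close>.
\<close>

lemma char_poly_rep_power:
  assumes deg: "has_degree scaleD d" and d: "0 < d"
  shows "\<exists>f. char_poly (\<phi> z) ^ d = map_poly \<iota> f"
proof -
  define n where "n = d * d"
  have dim: "dim UNIV = n"
    using deg by (simp add: has_degree_def n_def power2_eq_square)
  have n: "0 < n" using d by (simp add: n_def)
  obtain B where B: "independent B" "span B = UNIV"
    by (metis basis_exists top.extremum_uniqueI)
  have card_B: "card B = n"
    using dim_span_eq_card_independent[OF B(1)] B(2) dim by simp
  then have fin: "finite B" using n card_gt_0_iff by force
  obtain b where b: "bij_betw b {..<n} B"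
    using ex_bij_betw_nat_finite[OF fin] card_B by (auto simp: lessThan_atLeast0)
  have sum_b: "(\<Sum>x\<in>B. h x) = (\<Sum>i<n. h (b i))" for h :: "'d \<Rightarrow> 'k"
    using sum.reindex_bij_betw[OF b, of h] by simp
  have "\<exists>r. z * b j = (\<Sum>x\<in>B. scaleD (r x) x)" for j
    using span_finite[OF fin] B(2) by blast
  then obtain r where r: "\<And>j. z * b j = (\<Sum>x\<in>B. scaleD (r j x) x)" by metis
  have div: "k div d < d" and mod: "k mod d < d" if "k < n" for k
    using that d by (simp_all add: n_def less_mult_imp_div_less)
  define L where "L = mat n n (\<lambda>(i, j). r j (b i))"
  define L' where "L' = map_mat \<iota> L"
  \<comment> \<open>Column \<open>j\<close> of \<open>S\<close> lists the entries of the image of the \<open>j\<close>-th basis element, one column of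
    that image after the other.\<close>
  define S where "S = mat n n (\<lambda>(k, j). \<phi> (b j) $$ (k mod d, k div d))"
  define W where "W = diag_block_mat (replicate d (\<phi> z))"
  have dims [simp]: "L \<in> carrier_mat n n" "L' \<in> carrier_mat n n" "S \<in> carrier_mat n n"
    "W \<in> carrier_mat n n"
    by (auto simp: L_def L'_def S_def W_def n_def dim_diag_block_mat sum_list_replicate intro!: carrier_matI)
  \<comment> \<open>Both sides have as their columns the images of the products of \<open>z\<close> with the basis elements.\<close>
  have intertwine: "W * S = S * L'"
  proof (rule eq_matI)
    fix k j assume "k < dim_row (S * L')" "j < dim_col (S * L')"
    then have kj: "k < n" "j < n" using dims by auto
    note k = div[OF kj(1)] mod[OF kj(1)]
    have "(W * S) $$ (k, j) = (\<Sum>m<n. W $$ (k, m) * S $$ (m, j))"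
      by (rule index_mult_mat_sum[OF dims(4,3) kj])
    also have "\<dots> = (\<Sum>m<n. if k div d = m div d
        then \<phi> z $$ (k mod d, m mod d) * \<phi> (b j) $$ (m mod d, k div d) else 0)"
      using kj by (intro sum.cong)
        (auto simp: W_def S_def n_def index_diag_block_replicate[OF rep_carrier])
    also have "\<dots> = (\<Sum>m | m < n \<and> k div d = m div d.
        \<phi> z $$ (k mod d, m mod d) * \<phi> (b j) $$ (m mod d, k div d))"
      by (simp add: sum.If_cases Int_def)
    also have "\<dots> = (\<Sum>c<d. \<phi> z $$ (k mod d, c) * \<phi> (b j) $$ (c, k div d))"
    proof (rule sum.reindex_bij_witness[where j = "\<lambda>m. m mod d" and i = "\<lambda>c. k div d * d + c"])
      show "k div d * d + c \<in> {m. m < n \<and> k div d = m div d}" if "c \<in> {..<d}" for c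
      proof -
        have "k div d * d + c < Suc (k div d) * d" using that by simp
        also have "\<dots> \<le> d * d" using k by (intro mult_le_mono1) simp
        finally show ?thesis using that d by (simp add: n_def)
      qed
    qed (use d in \<open>auto simp: div_mult_mod_eq\<close>)
    also have "\<dots> = \<phi> (z * b j) $$ (k mod d, k div d)"
      unfolding rep_mult by (rule index_mult_mat_sum[OF rep_carrier rep_carrier k(2,1), symmetric])
    also have "\<dots> = (\<Sum>i<n. \<iota> (r j (b i)) * \<phi> (b i) $$ (k mod d, k div d))"
      unfolding r index_rep_linear_combination[OF fin k(2,1)] by (rule sum_b)
    also have "\<dots> = (S * L') $$ (k, j)"
      unfolding index_mult_mat_sum[OF dims(3,2) kj]
      using kj by (intro sum.cong) (auto simp: S_def L'_def L_def)
    finally show "(W * S) $$ (k, j) = (S * L') $$ (k, j)" .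
  qed (use carrier_matD[OF dims(2)] carrier_matD[OF dims(3)] carrier_matD[OF dims(4)] in auto)
  \<comment> \<open>The expansions of the matrix units in the images of the basis form the columns of an inverse of \<open>S\<close>.\<close>
  have "\<exists>c. \<forall>i<d. \<forall>j<d. (\<Sum>x\<in>B. c x * \<phi> x $$ (i, j))
      = (if i = k mod d \<and> j = k div d then 1 else 0)" for k
  proof -
    let ?E = "mat d d (\<lambda>(i, j). if i = k mod d \<and> j = k div d then 1 else 0) :: 'k mat"
    obtain c where "\<forall>i<d. \<forall>j<d. ?E $$ (i, j) = (\<Sum>x\<in>B. c x * \<phi> x $$ (i, j))"
      using rep_span[OF fin B(2), of ?E] by auto
    then have "(\<Sum>x\<in>B. c x * \<phi> x $$ (i, j)) = ?E $$ (i, j)" if "i < d" "j < d" for i j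
      using that by simp
    then show ?thesis by (intro exI[of _ c]) simp
  qed
  then obtain c where c: "\<And>k i j. i < d \<Longrightarrow> j < d \<Longrightarrow> (\<Sum>x\<in>B. c k x * \<phi> x $$ (i, j))
      = (if i = k mod d \<and> j = k div d then 1 else 0)" by metis
  define V where "V = mat n n (\<lambda>(j, k). c k (b j))"
  have V [simp]: "V \<in> carrier_mat n n" by (simp add: V_def)
  have SV: "S * V = 1\<^sub>m n"
  proof (rule eq_matI)
    fix m k assume "m < dim_row (1\<^sub>m n :: 'k mat)" "k < dim_col (1\<^sub>m n :: 'k mat)"
    then have mk: "m < n" "k < n" by auto
    have "(S * V) $$ (m, k) = (\<Sum>j<n. c k (b j) * \<phi> (b j) $$ (m mod d, m div d))"
      unfolding index_mult_mat_sum[OF dims(3) V mk]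
      using mk by (intro sum.cong) (auto simp: S_def V_def)
    also have "\<dots> = (\<Sum>x\<in>B. c k x * \<phi> x $$ (m mod d, m div d))" by (rule sum_b[symmetric])
    also have "\<dots> = (if m mod d = k mod d \<and> m div d = k div d then 1 else 0)"
      by (rule c[OF mod[OF mk(1)] div[OF mk(1)]])
    also have "\<dots> = 1\<^sub>m n $$ (m, k)"
      using mk by (simp, metis div_mult_mod_eq)
    finally show "(S * V) $$ (m, k) = 1\<^sub>m n $$ (m, k)" .
  qed (auto simp: S_def V_def)
  then have VS: "V * S = 1\<^sub>m n" using mat_mult_left_right_inverse[OF dims(3) V] by simp
  have "W = W * (S * V)" using right_mult_one_mat[OF dims(4)] by (simp add: SV)
  also have "\<dots> = W * S * V" by (rule assoc_mult_mat[OF dims(4,3) V, symmetric])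
  finally have "W = S * L' * V" by (simp only: intertwine)
  moreover have "{W, L', S, V} \<subseteq> carrier_mat n n" by simp
  ultimately have "similar_mat W L'"
    using similar_matI[OF _ SV VS] by blast
  then have "char_poly W = char_poly L'" by (rule char_poly_similar)
  then have "char_poly (\<phi> z) ^ d = map_poly \<iota> (char_poly L)"
    unfolding W_def char_poly_diag_block_replicate[OF rep_carrier] L'_def
      iota.char_poly_hom[OF dims(1)] .
  then show ?thesis by blast
qed

end

section \<open>Purely inseparable eigenvalues\<close>

lemma one_plus_monom_mult_power:
  fixes S :: "'a::comm_ring_1 poly"
  assumes "0 < L"
  shows "\<exists>T. (1 + monom 1 L * S) ^ n = 1 + monom 1 L * T \<and> coeff T 0 = of_nat n * coeff S 0"
proof (induction n)
  case 0
  show ?case by (intro exI[of _ 0]) simp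
next
  case (Suc n)
  then obtain T where T: "(1 + monom 1 L * S) ^ n = 1 + monom 1 L * T"
    and T0: "coeff T 0 = of_nat n * coeff S 0" by blast
  have "(1 + monom 1 L * S) ^ Suc n = 1 + monom 1 L * (S + T + monom 1 L * (S * T))"
    by (simp only: power_Suc T) (simp add: algebra_simps)
  moreover have "coeff (S + T + monom 1 L * (S * T)) 0 = of_nat (Suc n) * coeff S 0"
    using assms by (simp add: T0 coeff_mult_0 algebra_simps)
  ultimately show ?case by blast
qed

lemma coeff_one_plus_monom_mult_power:
  fixes S :: "'a::comm_ring_1 poly"
  assumes "0 < L"
  shows "coeff ((1 + monom 1 L * S) ^ n) L = of_nat n * coeff S 0"
  using one_plus_monom_mult_power[OF assms, of S n] assms
  by (auto simp: coeff_monom_mult)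

text \<open>
  Write \<open>n = q m\<close> with \<open>m\<close> prime to the characteristic \<open>p\<close> and \<open>q\<close> a power of \<open>p\<close>. If
  \<open>R = 1 + c X\<^sup>l +\<close> higher terms, then \<open>R\<^sup>q = 1 + c\<^sup>q X\<^bsup>l q\<^esup> +\<close> higher terms, so \<open>m c\<^sup>q\<close> is a coefficient
  of \<open>R\<^sup>n\<close>. The case of characteristic \<open>0\<close> is the one with \<open>q = 1\<close>, which the exponent \<open>k = 0\<close>
  covers because \<open>0\<^sup>0 = 1\<close>.
\<close>

lemma (in field_hom) second_coeff_inseparable_of_power:
  fixes R :: "'b poly"
  assumes R0: "coeff R 0 = 1" and Rj: "\<And>j. 0 < j \<Longrightarrow> j < l \<Longrightarrow> coeff R j = 0"
    and l: "0 < l" and n: "0 < n"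
    and range: "\<And>j. coeff (R ^ n) j \<in> range hom"
  shows "\<exists>k. (CHAR('b) = 0 \<longrightarrow> k = 0) \<and> coeff R l ^ (CHAR('b) ^ k) \<in> range hom"
proof -
  have divide: "y \<in> range hom" if "of_nat m * y \<in> range hom" "of_nat m \<noteq> (0::'b)" for m y
  proof -
    from that(1) obtain x where x: "of_nat m * y = hom x" by blast
    then have "y = hom (x / of_nat m)"
      using that(2) by (simp add: hom_div hom_of_nat field_simps)
    then show ?thesis by blast
  qed
  have "monom 1 l dvd R - 1"
    using R0 Rj by (auto simp: monom_1_dvd_iff' coeff_1)
  then obtain S where "R - 1 = monom 1 l * S" by (elim dvdE)
  then have S: "R = 1 + monom 1 l * S" by (simp add: algebra_simps)
  have Sl: "coeff S 0 = coeff R l"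
    using l by (simp add: S coeff_monom_mult)
  show ?thesis
  proof (cases "CHAR('b) = 0")
    case True
    have "of_nat n * coeff S 0 \<in> range hom"
      using range[of l] unfolding S coeff_one_plus_monom_mult_power[OF l] .
    moreover have "of_nat n \<noteq> (0::'b)"
      using True n by (simp add: of_nat_eq_0_iff_char_dvd)
    ultimately have "coeff R l \<in> range hom"
      using divide by (simp add: Sl)
    then show ?thesis by (intro exI[of _ 0]) simp
  next
    case False
    then have prime: "prime CHAR('b)"
      using prime_CHAR_semidom[where 'a='b] by simp
    have CHAR: "CHAR('b poly) = CHAR('b)"
      by simp
    obtain m where m: "n = CHAR('b) ^ multiplicity (CHAR('b)) n * m" "\<not> CHAR('b) dvd m"
      using multiplicity_decompose'[of n "CHAR('b)"] n prime by (metis not_prime_unit neq0_conv)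
    define k where "k = multiplicity (CHAR('b)) n"
    let ?q = "CHAR('b) ^ k"
    have q: "0 < ?q" using False by simp
    have "R ^ ?q = 1 + (monom 1 l * S) ^ ?q"
      using freshmans_dream'[of ?q k "1 :: 'b poly" "monom 1 l * S"] prime
      by (simp add: S CHAR)
    also have "\<dots> = 1 + monom 1 (l * ?q) * S ^ ?q"
      by (simp add: power_mult_distrib monom_power)
    finally have "R ^ n = (1 + monom 1 (l * ?q) * S ^ ?q) ^ m"
      using m(1) by (metis k_def power_mult)
    then have "of_nat m * coeff (S ^ ?q) 0 \<in> range hom"
      using range[of "l * ?q"] coeff_one_plus_monom_mult_power[of "l * ?q" "S ^ ?q" m] l q
      by simp
    moreover have "of_nat m \<noteq> (0::'b)"
      using m(2) by (simp add: of_nat_eq_0_iff_char_dvd)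
    ultimately have "coeff R l ^ ?q \<in> range hom"
      using divide by (simp add: coeff_0_power Sl)
    then show ?thesis using False by (intro exI[of _ k]) simp
  qed
qed

text \<open>
  The commutator with \<open>u\<close> is the difference of left and right multiplication by \<open>u\<close>. These two maps
  commute, so its iterates obey the binomial theorem.
\<close>

lemma commutator_power_expansion:
  fixes u y :: "'a::ring_1"
  shows "((\<lambda>y. u * y - y * u) ^^ n) y
    = (\<Sum>k\<le>n. of_int ((- 1) ^ k * int (n choose k)) * (u ^ (n - k) * y * u ^ k))"
proof (induction n)
  case 0
  then show ?case by simp
next
  case (Suc n)
  define c where "c = (\<lambda>n k. of_int ((- 1) ^ k * int (n choose k)) :: 'a)"
  define F where "F = (\<lambda>n k. u ^ (n - k) * y * u ^ k)"
  have left: "u * (c n k * F n k) = c n k * F (Suc n) k" if "k \<le> n" for k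
  proof -
    have "u * (c n k * F n k) = c n k * (u * F n k)"
      unfolding c_def by (metis mult.assoc mult_of_int_commute)
    then show ?thesis using that by (simp add: F_def Suc_diff_le mult.assoc)
  qed
  have right: "(c n k * F n k) * u = c n k * F (Suc n) (Suc k)" for k
    by (simp add: F_def mult.assoc power_commutes)
  have step: "((\<lambda>y. u * y - y * u) ^^ Suc n) y = u * (\<Sum>k\<le>n. c n k * F n k) - (\<Sum>k\<le>n. c n k * F n k) * u"
    using Suc by (simp add: c_def F_def)
  have "\<dots> = (\<Sum>k\<le>n. c n k * F (Suc n) k) - (\<Sum>k\<le>n. c n k * F (Suc n) (Suc k))"
    by (simp add: sum_distrib_left sum_distrib_right left right)
  also have "(\<Sum>k\<le>n. c n k * F (Suc n) k) = (\<Sum>k\<le>Suc n. c n k * F (Suc n) k)"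
    by (simp add: c_def binomial_eq_0)
  also have "\<dots> = c n 0 * F (Suc n) 0 + (\<Sum>k\<le>n. c n (Suc k) * F (Suc n) (Suc k))"
    by (rule sum.atMost_Suc_shift)
  also have "\<dots> - (\<Sum>k\<le>n. c n k * F (Suc n) (Suc k))
      = c n 0 * F (Suc n) 0 + (\<Sum>k\<le>n. (c n (Suc k) - c n k) * F (Suc n) (Suc k))"
    by (simp add: sum_subtractf left_diff_distrib)
  also have "\<dots> = c (Suc n) 0 * F (Suc n) 0 + (\<Sum>k\<le>n. c (Suc n) (Suc k) * F (Suc n) (Suc k))"
  proof -
    have "c (Suc n) (Suc k) = c n (Suc k) - c n k" for k
      unfolding c_def of_int_diff[symmetric] by (rule arg_cong[of _ _ of_int]) (simp add: algebra_simps)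
    then show ?thesis by (simp add: c_def)
  qed
  also have "\<dots> = (\<Sum>k\<le>Suc n. c (Suc n) k * F (Suc n) k)"
    by (rule sum.atMost_Suc_shift[symmetric])
  finally show ?case unfolding step by (simp add: c_def F_def)
qed

text \<open>
  Modulo the prime \<open>p\<close> the expansion above collapses to \<open>\<delta>\<^sup>p(y) = u\<^sup>p y - y u\<^sup>p = 0\<close>, where
  \<open>\<delta>(y) = u y - y u\<close>. The last two nonzero iterates \<open>s\<close> and \<open>v = \<delta>(s)\<close> exist because \<open>\<delta>(y) \<noteq> 0\<close>.
  As \<open>v\<close> commutes with \<open>u\<close>, the element \<open>s v\<^sup>-\<^sup>1\<close> has commutator \<open>v v\<^sup>-\<^sup>1 = 1\<close> with \<open>u\<close>.
\<close>

lemma exists_commutator_one: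
  fixes u y :: "'a::division_ring"
  assumes p: "prime p" "of_nat p = (0::'a)" and central: "\<And>x. u ^ p * x = x * u ^ p"
    and y: "u * y \<noteq> y * u"
  shows "\<exists>t. u * t - t * u = 1"
proof -
  define \<delta> where "\<delta> = (\<lambda>y. u * y - y * u)"
  have "(\<delta> ^^ p) y = (\<Sum>k\<le>p. of_int ((- 1) ^ k * int (p choose k)) * (u ^ (p - k) * y * u ^ k))"
    unfolding \<delta>_def by (rule commutator_power_expansion)
  also have "\<dots> = (\<Sum>k\<in>{0, p}. of_int ((- 1) ^ k * int (p choose k)) * (u ^ (p - k) * y * u ^ k))"
  proof (intro sum.mono_neutral_right ballI)
    fix k assume "k \<in> {..p} - {0, p}"
    then have "p dvd (p choose k)"
      using p(1) by (intro dvd_choose_prime) auto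
    then have "of_nat (p choose k) = (0::'a)"
      using p(2) by (auto elim!: dvdE)
    then show "of_int ((- 1) ^ k * int (p choose k)) * (u ^ (p - k) * y * u ^ k) = 0" by simp
  qed auto
  also have "\<dots> = u ^ p * y + (- 1) ^ p * (y * u ^ p)"
    using prime_gt_0_nat[OF p(1)] by simp
  also have "(- 1) ^ p = (- 1 :: 'a)"
  proof (cases "p = 2")
    case True
    then have "1 + 1 = (0::'a)" using p(2) by simp
    then show ?thesis using True by (simp add: eq_neg_iff_add_eq_0)
  next
    case False
    then have "odd p" using p(1) prime_odd_nat[of p] prime_ge_2_nat[of p] by auto
    then show ?thesis by simp
  qed
  finally have nil: "(\<delta> ^^ p) y = 0" using central by simp
  define m where "m = (LEAST m. (\<delta> ^^ m) y = 0)"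
  have m0: "(\<delta> ^^ m) y = 0" unfolding m_def using nil by (rule LeastI)
  have m_least: "(\<delta> ^^ i) y \<noteq> 0" if "i < m" for i
    using that not_less_Least unfolding m_def by blast
  have "m \<noteq> 0" "m \<noteq> 1"
    using m0 y by (auto simp: \<delta>_def intro!: gr0I)
  then obtain r where r: "m = Suc (Suc r)" by (metis One_nat_def not0_implies_Suc)
  define s where "s = (\<delta> ^^ r) y"
  define v where "v = \<delta> s"
  have v0: "v \<noteq> 0" using m_least[of "Suc r"] r by (simp add: v_def s_def)
  have "\<delta> v = 0" using m0 r by (simp add: v_def s_def)
  then have "u * v = v * u" by (simp add: \<delta>_def)
  then have uv: "inverse v * u = u * inverse v"
    using v0 by (metis mult.assoc left_inverse right_inverse mult_1 mult_1_right)
  have "u * (s * inverse v) - (s * inverse v) * u = (u * s - s * u) * inverse v"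
    by (simp add: mult.assoc uv left_diff_distrib)
  also have "u * s - s * u = v" by (simp add: v_def \<delta>_def)
  finally have "u * (s * inverse v) - (s * inverse v) * u = v * inverse v" .
  then show ?thesis using v0 by auto
qed

context algebra_representation
begin

text \<open>
  Both products have \<open>a\<close> times the diagonal entry of \<open>\<phi>(t)\<close> as their entry at \<open>(j, j)\<close>, so the
  commutator has the entry \<open>0\<close> there.
\<close>

lemma commutator_neq_one_if_isolated:
  assumes iso: "isolated_index (\<phi> u) j a"
  shows "u * t - t * u \<noteq> 1"
proof
  assume "u * t - t * u = 1"
  then have "\<phi> u * \<phi> t - \<phi> t * \<phi> u = 1\<^sub>m d"
    by (simp flip: rep_mult rep_diff add: rep_one)
  moreover have j: "j < d" using iso by (simp add: isolated_index_def)
  ultimately have "(\<phi> u * \<phi> t) $$ (j, j) - (\<phi> t * \<phi> u) $$ (j, j) = 1"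
    using index_minus_mat(1)[of j "\<phi> t * \<phi> u" j "\<phi> u * \<phi> t"] by simp
  then show False
    using isolated_index_mult_left[OF rep_carrier rep_carrier iso j]
      isolated_index_mult_right[OF rep_carrier rep_carrier iso j] by (simp add: mult.commute)
qed

text \<open>
  By induction \<open>w\<^sup>p\<close> is a scalar, hence central; if \<open>w\<close> were not central, it would have a commutator
  equal to \<open>1\<close>.
\<close>

lemma scalar_if_inseparable_eigenvalue:
  assumes "isolated_index (\<phi> w) j a" and "CHAR('k) = 0 \<Longrightarrow> k = 0"
    and "a ^ (CHAR('k) ^ k) \<in> range \<iota>"
  shows "\<exists>r. w = scaleD r 1"
  using assms
proof (induction k arbitrary: w a)
  case 0
  then obtain r where "a = \<iota> r" by auto
  then show ?case using 0 eq_scale_if_rational_eigenvalue by blast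
next
  case (Suc k)
  define p where "p = CHAR('k)"
  have p: "prime p"
    using Suc.prems(2) prime_CHAR_semidom[where 'a='k] by (auto simp: p_def)
  \<comment> \<open>The two fields and the division algebra have the same characteristic.\<close>
  have "\<iota> (of_nat p) = 0" by (simp add: iota.hom_of_nat p_def)
  then have "of_nat p = (0::'f)" by simp
  moreover have "scaleD (of_nat p) 1 = of_nat p" by (induction p) (simp_all add: scale_left_distrib)
  ultimately have p0: "of_nat p = (0::'d)" by (metis scale_zero_left)
  have "isolated_index (\<phi> (w ^ p)) j (a ^ p)"
    unfolding rep_power by (rule isolated_index_power[OF rep_carrier Suc.prems(1)])
  moreover have "(a ^ p) ^ (CHAR('k) ^ k) \<in> range \<iota>"
    using Suc.prems(3) by (simp add: p_def power_mult)
  ultimately have "\<exists>r. w ^ p = scaleD r 1"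
    using Suc.IH[of "w ^ p" "a ^ p"] Suc.prems(2) by auto
  then have central: "w ^ p * x = x * w ^ p" for x using central_iff_scalar by blast
  have "w * y = y * w" for y
  proof (rule ccontr)
    assume "w * y \<noteq> y * w"
    then obtain t where "w * t - t * w = 1"
      using exists_commutator_one[OF p p0 central] by blast
    then show False using commutator_neq_one_if_isolated[OF Suc.prems(1)] by blast
  qed
  then show ?case using central_iff_scalar by blast
qed

end

section \<open>Monomial matrices\<close>

lemma index_pow_mat_monomial:
  fixes A :: "'a::comm_semiring_1 mat"
  assumes A: "A \<in> carrier_mat d d" and p: "p permutes {..<d}"
    and A_p: "\<And>i j. i < d \<Longrightarrow> j < d \<Longrightarrow> A $$ (i, j) \<noteq> 0 \<longleftrightarrow> i = p j"
    and ij: "i < d" "j < d"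
  shows "(A ^\<^sub>m n) $$ (i, j)
    = (if i = (p ^^ n) j then \<Prod>k<n. A $$ (p ((p ^^ k) j), (p ^^ k) j) else 0)"
  using ij
proof (induction n arbitrary: j)
  case 0
  then show ?case using A by simp
next
  case (Suc n)
  have pj: "p j < d" using permutes_in_image[OF p, of j] Suc.prems by simp
  have "(A ^\<^sub>m Suc n) $$ (i, j) = (\<Sum>k<d. (A ^\<^sub>m n) $$ (i, k) * A $$ (k, j))"
    using A Suc.prems by (simp add: scalar_prod_def lessThan_atLeast0 cong: sum.cong_simp)
  also have "\<dots> = (\<Sum>k\<in>{p j}. (A ^\<^sub>m n) $$ (i, k) * A $$ (k, j))"
    using pj Suc.prems A_p[of _ j] by (intro sum.mono_neutral_right) (auto, metis mult_zero_right)
  also have "\<dots> = (A ^\<^sub>m n) $$ (i, p j) * A $$ (p j, j)" by simp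
  also have "\<dots> = (if i = (p ^^ Suc n) j
      then \<Prod>k<Suc n. A $$ (p ((p ^^ k) j), (p ^^ k) j) else 0)"
    using Suc.IH[OF Suc.prems(1) pj]
    by (simp add: funpow_swap1 prod.lessThan_Suc_shift mult.commute del: prod.lessThan_Suc)
  finally show ?case .
qed

text \<open>
  In the Leibniz expansion of the characteristic polynomial, the permutation \<open>\<pi>\<close> contributes only if
  it agrees with \<open>p\<close> on every point that it moves. The set \<open>S \<pi>\<close> of moved points is then a union of
  cycles of \<open>p\<close>, and the contribution has degree \<open>d - card (S \<pi>)\<close>. So among the nonidentical
  permutations, only the one that moves exactly the shortest cycle can reach degree \<open>d - l\<close>. If
  \<open>l = 1\<close>, that cycle consists of a fixed point, and the coefficient comes from the diagonal entry
  there, through the identity permutation. The two signs lead to the same subfield, so the sign of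
  the cycle is left open.
\<close>

lemma coeff_char_poly_shortest_cycle:
  fixes B :: "'a::field mat"
  assumes B: "B \<in> carrier_mat d d" and p: "p permutes {..<d}"
    and B_p: "\<And>i j. i < d \<Longrightarrow> j < d \<Longrightarrow> B $$ (i, j) \<noteq> 0 \<longleftrightarrow> j = p i"
    and x: "x < d"
    and shortest: "\<And>i. i < d \<Longrightarrow> orbit p i \<noteq> orbit p x \<Longrightarrow> card (orbit p x) < card (orbit p i)"
  defines "l \<equiv> card (orbit p x)" and "a \<equiv> \<Prod>i\<in>orbit p x. B $$ (i, p i)"
  shows "0 < j \<Longrightarrow> j < l \<Longrightarrow> coeff (char_poly B) (d - j) = 0"
    and "coeff (char_poly B) (d - l) \<in> {a, - a}"
proof -
  define f where "f = (\<lambda>\<pi> i. char_poly_matrix B $$ (i, \<pi> i))"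
  define S where "S = (\<lambda>\<pi>. {i \<in> {..<d}. \<pi> i \<noteq> i})"
  have perm: "permutation p" using p by (auto simp: permutation_permutes)
  have orbit_sub: "orbit p i \<subseteq> {..<d}" if "i < d" for i
    using permutes_orbit_subset[OF p, of i] that by simp
  have fin_orbit: "finite (orbit p i)" if "i < d" for i
    using orbit_sub[OF that] finite_subset by blast
  have self: "i \<in> orbit p i" for i using permutation_self_in_orbit[OF perm] .
  have l_pos: "0 < l" unfolding l_def using self[of x] fin_orbit[OF x] card_gt_0_iff by blast
  have l_le: "l \<le> d" unfolding l_def using card_mono[OF _ orbit_sub[OF x]] by simp
  have l_min: "l \<le> card (orbit p i)" if "i < d" for i
    using shortest[OF that] unfolding l_def by (cases "orbit p i = orbit p x") auto

  have f_moved: "f \<pi> i = [:- (B $$ (i, \<pi> i)):]" if "\<pi> permutes {..<d}" "i \<in> S \<pi>" for \<pi> i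
    using that B permutes_in_image[OF that(1), of i] by (auto simp: f_def S_def char_poly_matrix_def)
  have f_fixed: "f \<pi> i = [:- (B $$ (i, i)), 1:]" if "i < d" "i \<notin> S \<pi>" for \<pi> i
    using that B by (auto simp: f_def S_def char_poly_matrix_def)
  have split: "(\<Prod>i<d. f \<pi> i) = (\<Prod>i\<in>S \<pi>. f \<pi> i) * (\<Prod>i\<in>{..<d} - S \<pi>. f \<pi> i)" for \<pi>
    using prod.subset_diff[of "S \<pi>" "{..<d}" "f \<pi>"] by (auto simp: S_def mult.commute)
  have prod_S: "(\<Prod>i\<in>S \<pi>. f \<pi> i) = [:\<Prod>i\<in>S \<pi>. - (B $$ (i, \<pi> i)):]" if "\<pi> permutes {..<d}" for \<pi>
    using f_moved[OF that] by (simp add: prod_to_poly cong: prod.cong_simp)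
  have deg: "degree (\<Prod>i\<in>{..<d} - S \<pi>. f \<pi> i) = d - card (S \<pi>)"
    and lead: "coeff (\<Prod>i\<in>{..<d} - S \<pi>. f \<pi> i) (d - card (S \<pi>)) = 1" for \<pi>
  proof -
    have ne: "f \<pi> i \<noteq> 0" "degree (f \<pi> i) = 1" "lead_coeff (f \<pi> i) = 1" if "i \<in> {..<d} - S \<pi>" for i
      using that by (auto simp: f_fixed)
    show deg: "degree (\<Prod>i\<in>{..<d} - S \<pi>. f \<pi> i) = d - card (S \<pi>)"
      using ne by (subst degree_prod_eq_sum_degree) (simp_all add: S_def card_Diff_subset subset_eq)
    show "coeff (\<Prod>i\<in>{..<d} - S \<pi>. f \<pi> i) (d - card (S \<pi>)) = 1"
      using lead_coeff_prod[of "f \<pi>" "{..<d} - S \<pi>"] ne by (simp add: deg)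
  qed
  have coeff_above: "coeff (\<Prod>i<d. f \<pi> i) (d - j) = 0"
    if "\<pi> permutes {..<d}" "j < card (S \<pi>)" "card (S \<pi>) \<le> d" for \<pi> j
    using that deg[of \<pi>] by (simp add: split prod_S coeff_eq_0 )
  have S_le: "card (S \<pi>) \<le> d" for \<pi>
    using card_mono[of "{..<d}" "S \<pi>"] by (auto simp: S_def)
  have prod0: "(\<Prod>i<d. f \<pi> i) = 0" if "\<pi> permutes {..<d}" "i \<in> S \<pi>" "\<pi> i \<noteq> p i" for \<pi> i
  proof -
    have "B $$ (i, \<pi> i) = 0"
      using that B_p[of i "\<pi> i"] permutes_in_image[OF that(1), of i] by (auto simp: S_def)
    then have "f \<pi> i = 0" using f_moved[OF that(1,2)] by simp
    then show ?thesis using that(2) by (auto simp: S_def)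
  qed
  have orbit_in_S: "orbit p i \<subseteq> S \<pi>"
    if \<pi>: "\<pi> permutes {..<d}" and eq: "\<And>k. k \<in> S \<pi> \<Longrightarrow> \<pi> k = p k" and i: "i \<in> S \<pi>" for \<pi> i
  proof
    have step: "p k \<in> S \<pi>" if "k \<in> S \<pi>" for k
      using that eq[OF that] permutes_in_image[OF \<pi>, of k] injD[OF permutes_inj[OF \<pi>], of "p k" k]
      by (auto simp: S_def)
    fix k assume "k \<in> orbit p i"
    then show "k \<in> S \<pi>" by induction (auto intro: step i)
  qed
  define \<pi>C where "\<pi>C = (\<lambda>i. if i \<in> orbit p x then p i else i)"
  have key: "\<pi> = id \<or> l < card (S \<pi>) \<or> (l = card (S \<pi>) \<and> \<pi> = \<pi>C \<and> S \<pi> = orbit p x)"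
    if \<pi>: "\<pi> permutes {..<d}" and nz: "(\<Prod>i<d. f \<pi> i) \<noteq> 0" for \<pi>
  proof (cases "S \<pi> = {}")
    case True
    then have "\<pi> = id" using permutes_not_in[OF \<pi>] by (auto simp: S_def fun_eq_iff)
    then show ?thesis by simp
  next
    case False
    then obtain i where i: "i \<in> S \<pi>" by blast
    have eq: "\<pi> k = p k" if "k \<in> S \<pi>" for k
      using prod0[OF \<pi> that] nz by blast
    have id: "i < d" using i by (simp add: S_def)
    have finS: "finite (S \<pi>)" by (simp add: S_def)
    have sub: "orbit p i \<subseteq> S \<pi>" using orbit_in_S[OF \<pi> eq i] .
    then have le: "card (orbit p i) \<le> card (S \<pi>)" by (rule card_mono[OF finS])
    show ?thesis
    proof (cases "l < card (S \<pi>)")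
      case False
      then have eql: "card (S \<pi>) = l" "card (orbit p i) = l" using le l_min[OF id] by auto
      then have "orbit p i = orbit p x" using shortest[OF id] l_def by fastforce
      moreover have "orbit p i = S \<pi>" using card_subset_eq[OF finS sub] eql by simp
      ultimately have S_eq: "S \<pi> = orbit p x" by simp
      have "\<pi> k = \<pi>C k" for k
      proof (cases "k \<in> orbit p x")
        case True then show ?thesis using eq S_eq by (simp add: \<pi>C_def)
      next
        case False
        then have "k \<notin> S \<pi>" using S_eq by simp
        then have "\<pi> k = k" using permutes_not_in[OF \<pi>, of k] by (auto simp: S_def)
        then show ?thesis using False by (simp add: \<pi>C_def)
      qed
      then show ?thesis using eql S_eq by auto
    qed simp
  qed
  have char_poly: "coeff (char_poly B) n
      = (\<Sum>\<pi> | \<pi> permutes {..<d}. signof \<pi> * coeff (\<Prod>i<d. f \<pi> i) n)" for n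
  proof -
    have "char_poly B = (\<Sum>\<pi> | \<pi> permutes {..<d}. signof \<pi> * (\<Prod>i<d. f \<pi> i))"
      unfolding char_poly_def det_def'[OF char_poly_matrix_closed[OF B]]
      by (simp add: f_def lessThan_atLeast0)
    moreover have "coeff (signof \<pi> * q) n = signof \<pi> * coeff q n" for \<pi> and q :: "'a poly"
      by (cases "sign \<pi> = 1") (simp_all add: sign_def)
    ultimately show ?thesis by (simp add: coeff_sum)
  qed
  \<comment> \<open>A fixed point of \<open>p\<close> is a cycle of length one, so there is none unless \<open>l = 1\<close>; hence for
    \<open>l > 1\<close> the diagonal of \<open>B\<close> vanishes and the identity permutation contributes just \<open>X\<^sup>d\<close>.\<close>
  have fixed: "l = 1" if "i < d" "p i = i" for i
    using l_min[OF that(1)] l_pos that(2) orbit_eq_singleton_iff[of p i] by simp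
  have coeff_id: "coeff (\<Prod>i<d. f id i) (d - j) = 0" if "1 < l" "0 < j" "j \<le> d" for j
  proof -
    have "f id i = [:0, 1:]" if "i < d" for i
      using f_fixed[of i id] fixed[of i] B_p[of i i] that \<open>1 < l\<close> by (force simp: S_def)
    then have "(\<Prod>i<d. f id i) = monom 1 d"
      by (simp add: monom_altdef)
    then show ?thesis using that by simp
  qed
  have coeff_zero: "coeff (\<Prod>i<d. f \<pi> i) (d - j) = 0"
    if "\<pi> permutes {..<d}" "1 < l" "0 < j" "j \<le> l" "j < l \<or> \<pi> \<noteq> \<pi>C" for \<pi> j
  proof (cases "(\<Prod>i<d. f \<pi> i) = 0")
    case False
    from key[OF that(1) this] show ?thesis
    proof (elim disjE)
      assume "\<pi> = id"
      then show ?thesis using coeff_id[of j] that l_le by simp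
    qed (use that S_le[of \<pi>] in \<open>auto intro: coeff_above\<close>)
  next
    case True
    then show ?thesis by (simp only: coeff_0)
  qed
  show "coeff (char_poly B) (d - j) = 0" if "0 < j" "j < l"
    unfolding char_poly using coeff_zero[of _ j] that by (intro sum.neutral) auto
  show "coeff (char_poly B) (d - l) \<in> {a, - a}"
  proof (cases "l = 1")
    case True
    have orbit_x: "orbit p x = {x}"
      using self[of x] True card_1_singletonE unfolding l_def by (metis singletonD)
    then have \<pi>C_id: "\<pi>C = id"
      using orbit_eq_singleton_iff[of p x] unfolding \<pi>C_def orbit_x by (auto simp: fun_eq_iff)
    have "coeff (char_poly B) (d - l) = signof id * coeff (\<Prod>i<d. f id i) (d - l)"
    proof -
      have "coeff (\<Prod>i<d. f \<pi> i) (d - l) = 0" if "\<pi> permutes {..<d}" "\<pi> \<noteq> id" for \<pi>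
      proof (cases "(\<Prod>i<d. f \<pi> i) = 0")
        case True
        then show ?thesis by (simp only: coeff_0)
      next
        case False
        then show ?thesis
          using key[OF that(1)] that S_le[of \<pi>] coeff_above[OF that(1), of l] \<pi>C_id by blast
      qed
      then have "coeff (char_poly B) (d - l) = (\<Sum>\<pi>\<in>{id}. signof \<pi> * coeff (\<Prod>i<d. f \<pi> i) (d - l))"
        unfolding char_poly by (intro sum.mono_neutral_right) (auto simp: finite_permutations)
      then show ?thesis by simp
    qed
    moreover have "coeff (\<Prod>i<d. f id i) (d - l) = - a"
    proof -
      have "f id i = [:0, 1:]" if "i \<in> {..<d} - {x}" for i
      proof -
        have "p i \<noteq> i"
        proof
          assume "p i = i"
          then have "orbit p i = {i}" by (simp add: orbit_eq_singleton_iff)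
          then show False using shortest[of i] that orbit_x by auto
        qed
        then show ?thesis
          using f_fixed[of i id] B_p[of i i] that by (auto simp: S_def)
      qed
      then have "(\<Prod>i\<in>{..<d} - {x}. f id i) = monom 1 (d - 1)"
        using x by (simp add: monom_altdef)
      moreover have "f id x = [:- a, 1:]"
        using f_fixed[of x id] x orbit_eq_singleton_iff[of p x]
        unfolding a_def orbit_x by (simp add: S_def)
      ultimately have "(\<Prod>i<d. f id i) = monom 1 (d - 1) * [:- a, 1:]"
        using x prod.remove[of "{..<d}" x "f id"] by (simp add: mult.commute)
      then show ?thesis using True x by (cases d) (auto simp: coeff_pCons split: nat.split)
    qed
    ultimately show ?thesis by simp
  next
    case False
    then have l1: "1 < l" using l_pos by simp
    have step: "p i \<in> orbit p x" if "i \<in> orbit p x" for i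
      using that by (rule orbit.step)
    have inj: "inj_on p (orbit p x)" using permutes_inj[OF p] inj_on_subset by blast
    have "p ` orbit p x = orbit p x"
      using step by (intro endo_inj_surj[OF fin_orbit[OF x] _ inj]) auto
    then have "bij_betw p (orbit p x) (orbit p x)" using inj by (simp add: bij_betw_def)
    then have "bij_betw \<pi>C (orbit p x) (orbit p x)"
      by (subst bij_betw_cong[of _ _ p]) (auto simp: \<pi>C_def)
    then have "\<pi>C permutes orbit p x"
      by (rule bij_imp_permutes) (simp add: \<pi>C_def)
    then have C: "\<pi>C permutes {..<d}"
      using permutes_subset orbit_sub[OF x] by blast
    have "p i \<noteq> i" if "i \<in> orbit p x" for i
      using fixed[of i] that orbit_sub[OF x] False by auto
    then have S_C: "S \<pi>C = orbit p x"
      using orbit_sub[OF x] by (auto simp: S_def \<pi>C_def)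
    have "coeff (char_poly B) (d - l) = (\<Sum>\<pi>\<in>{\<pi>C}. signof \<pi> * coeff (\<Prod>i<d. f \<pi> i) (d - l))"
      unfolding char_poly using C coeff_zero[of _ l] l1
      by (intro sum.mono_neutral_right) (auto simp: finite_permutations)
    also have "\<dots> = signof \<pi>C * coeff (\<Prod>i<d. f \<pi>C i) (d - l)" by simp
    also have "coeff (\<Prod>i<d. f \<pi>C i) (d - l) = (\<Prod>i\<in>orbit p x. - (B $$ (i, \<pi>C i)))"
      using lead[of \<pi>C] unfolding split[of \<pi>C] prod_S[OF C] by (simp add: S_C l_def)
    also have "(\<Prod>i\<in>orbit p x. - (B $$ (i, \<pi>C i))) = (- 1) ^ l * a"
      by (simp add: prod_uminus l_def a_def \<pi>C_def cong: prod.cong_simp)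
    finally show ?thesis
      by (cases "even l"; cases "sign \<pi>C = 1") (auto simp: sign_def)
  qed
qed

lemma bij_betw_funpow_orbit:
  assumes "x \<in> orbit f x"
  shows "bij_betw (\<lambda>k. (f ^^ k) x) {..<card (orbit f x)} (orbit f x)"
    and "(f ^^ card (orbit f x)) x = x"
proof -
  let ?n = "funpow_dist1 f x x"
  have "inj_on (\<lambda>k. (f ^^ k) x) {0..<?n}" using assms by (rule inj_on_funpow_dist1)
  moreover have "orbit f x = (\<lambda>k. (f ^^ k) x) ` {0..<?n}" using assms by (rule orbit_conv_funpow_dist1)
  ultimately have "bij_betw (\<lambda>k. (f ^^ k) x) {..<?n} (orbit f x)"
    by (simp add: bij_betw_def lessThan_atLeast0)
  moreover from this have "card (orbit f x) = ?n" using bij_betw_same_card by fastforce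
  moreover have "(f ^^ ?n) x = x" using assms by (rule funpow_dist1_prop)
  ultimately show "bij_betw (\<lambda>k. (f ^^ k) x) {..<card (orbit f x)} (orbit f x)"
    and "(f ^^ card (orbit f x)) x = x" by simp_all
qed

section \<open>Conjugates of elements of the division algebra\<close>

text \<open>
  The diagonal entry \<open>a\<close> of the \<open>l\<close>-th power at \<open>x\<close> is the product of the entries along the shortest
  cycle. It is also, up to sign, a coefficient of the characteristic polynomial. The first description
  makes it an eigenvalue of \<open>z\<^sup>l\<close>, the second makes it purely inseparable over \<open>F\<close>; together they
  force \<open>z\<^sup>l\<close> into \<open>F\<close>.
\<close>

lemma (in split_representation) shortest_cycle_is_full:
  assumes deg: "has_degree scaleD d"
    and P: "P \<in> carrier_mat d d" "Q \<in> carrier_mat d d" "P * Q = 1\<^sub>m d" "Q * P = 1\<^sub>m d"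
    and p: "p permutes {..<d}"
    and A_p: "\<And>i j. i < d \<Longrightarrow> j < d \<Longrightarrow> (P * \<phi> z * Q) $$ (i, j) \<noteq> 0 \<longleftrightarrow> i = p j"
    and x: "x < d"
    and shortest: "\<And>i. i < d \<Longrightarrow> orbit p i \<noteq> orbit p x \<Longrightarrow> card (orbit p x) < card (orbit p i)"
  shows "card (orbit p x) = d"
proof -
  define A where "A = P * \<phi> z * Q"
  define l where "l = card (orbit p x)"
  have A: "A \<in> carrier_mat d d" using P by (auto simp: A_def)
  have d: "0 < d" using x by simp
  have A_p: "A $$ (i, j) \<noteq> 0 \<longleftrightarrow> i = p j" if "i < d" "j < d" for i j
    using A_p[OF that] by (simp add: A_def)
  interpret conj: algebra_representation scaleD \<iota> d "\<lambda>x. P * \<phi> x * Q"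
    using P by (rule rep_conjugate)
  have perm: "permutation p" using p by (auto simp: permutation_permutes)
  have self: "i \<in> orbit p i" for i using permutation_self_in_orbit[OF perm] .
  have orbit_sub: "orbit p i \<subseteq> {..<d}" if "i < d" for i
    using permutes_orbit_subset[OF p, of i] that by simp
  have fin_orbit: "finite (orbit p i)" if "i < d" for i
    using orbit_sub[OF that] finite_subset by blast
  have l_pos: "0 < l" unfolding l_def using self[of x] fin_orbit[OF x] card_gt_0_iff by blast
  have l_le: "l \<le> d" unfolding l_def using card_mono[OF _ orbit_sub[OF x]] by simp

  define a where "a = (\<Prod>i\<in>orbit p x. A $$ (p i, i))"
  have pow: "(A ^\<^sub>m n) $$ (i, j) = (if i = (p ^^ n) j
      then \<Prod>k<n. A $$ (p ((p ^^ k) j), (p ^^ k) j) else 0)" if "i < d" "j < d" for n i j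
    by (rule index_pow_mat_monomial[OF A p A_p that])
  have pn: "(p ^^ n) i < d" if "i < d" for n i
    using that permutes_in_image[OF p] by (induction n) auto
  have a_prod: "a = (\<Prod>k<l. A $$ (p ((p ^^ k) x), (p ^^ k) x))"
    unfolding a_def l_def
    by (rule prod.reindex_bij_betw[OF bij_betw_funpow_orbit(1)[OF self], symmetric])
  have p_l_x: "(p ^^ l) x = x" unfolding l_def by (rule bij_betw_funpow_orbit(2)[OF self])
  have inj_pn: "(p ^^ l) i = x \<longleftrightarrow> i = x" for i
    using inj_fn[OF permutes_inj[OF p], of l] p_l_x by (metis injD)
  have isolated: "isolated_index (A ^\<^sub>m l) x a"
    using x A pow[of x x l] pow[of _ x l] pow[of x _ l] p_l_x inj_pn a_prod
    by (auto simp: isolated_index_def)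

  have "similar_mat A (\<phi> z)"
    using P A by (intro similar_matI[of _ _ P Q d]) (auto simp: A_def)
  then have cp: "char_poly A = char_poly (\<phi> z)" by (rule char_poly_similar)
  \<comment> \<open>The reversed polynomial brings the coefficients near the leading one to the front.\<close>
  define R where "R = reflect_poly (char_poly A)"
  have monic: "degree (char_poly A) = d" "coeff (char_poly A) d = 1"
    using degree_monic_char_poly[OF A] by auto
  have R: "coeff R j = coeff (char_poly A) (d - j)" if "j \<le> d" for j
    using that by (simp add: R_def coeff_reflect_poly monic)
  \<comment> \<open>The transpose turns the nonzero entries \<open>(p j, j)\<close> into the entries \<open>(i, p i)\<close>.\<close>
  note T = coeff_char_poly_shortest_cycle[of "transpose_mat A" d p x, OF _ p _ x shortest]
  have R_gap: "coeff R j = 0" if "0 < j" "j < l" for j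
    using T(1)[of j] A A_p R[of j] that l_le by (auto simp: l_def)
  have c: "coeff R l \<in> {a, - a}"
  proof -
    have a_eq: "(\<Prod>i\<in>orbit p x. transpose_mat A $$ (i, p i)) = a"
      unfolding a_def using orbit_sub[OF x] A pn[of _ 1] by (intro prod.cong) auto
    show ?thesis
      using T(2) A A_p R[OF l_le] unfolding a_eq by (auto simp: l_def)
  qed
  have R_range: "coeff (R ^ d) j \<in> range \<iota>" for j
  proof -
    obtain f where f: "char_poly A ^ d = map_poly \<iota> f"
      using char_poly_rep_power[OF deg d] cp by metis
    have "R ^ d = reflect_poly (map_poly \<iota> f)"
      by (simp add: R_def reflect_poly_power f[symmetric])
    then show ?thesis
      by (auto simp: coeff_reflect_poly intro: range_eqI[of 0 \<iota> 0])
  qed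
  have "\<exists>k. (CHAR('k) = 0 \<longrightarrow> k = 0) \<and> coeff R l ^ (CHAR('k) ^ k) \<in> range \<iota>"
    using R_gap l_pos d R_range
    by (rule iota.second_coeff_inseparable_of_power[rotated]) (use R[of 0] monic in simp_all)
  then obtain k where k: "CHAR('k) = 0 \<longrightarrow> k = 0"
    and c_pow: "coeff R l ^ (CHAR('k) ^ k) \<in> range \<iota>" by (elim exE conjE)
  have "a ^ (CHAR('k) ^ k) \<in> range \<iota>"
  proof -
    have neg: "- y \<in> range \<iota>" if "y \<in> range \<iota>" for y
      using that by (auto simp flip: iota.hom_uminus)
    from c have "a = coeff R l \<or> a = - coeff R l" by auto
    then have "a ^ n = coeff R l ^ n \<or> a ^ n = - (coeff R l ^ n)" for n
      by (cases "even n") auto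
    then show ?thesis using c_pow neg[OF c_pow] by metis
  qed
  moreover have "isolated_index (P * \<phi> (z ^ l) * Q) x a"
    using isolated by (simp only: conj.rep_power A_def)
  ultimately obtain r where "z ^ l = scaleD r 1"
    using conj.scalar_if_inseparable_eigenvalue[of "z ^ l" x a k] k by auto
  then have scalar: "(A ^\<^sub>m l) $$ (i, j) = 0" if "i < d" "j < d" "i \<noteq> j" for i j
    using conj.index_rep_scale_one[of i j r] that conj.rep_power[of z l] by (simp add: A_def)
  \<comment> \<open>The entry at \<open>((p ^^ l) i, i)\<close> is a product of nonzero entries, so it cannot be off the diagonal.\<close>
  have p_l: "(p ^^ l) i = i" if i: "i < d" for i
  proof (rule ccontr)
    assume "(p ^^ l) i \<noteq> i"
    then have "(\<Prod>k<l. A $$ (p ((p ^^ k) i), (p ^^ k) i)) = 0"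
      using scalar[OF pn[OF i, of l] i] pow[OF pn[OF i, of l] i] by simp
    then show False using A_p pn[OF i] pn[OF i, of "Suc _"] by auto
  qed
  have "orbit p i = orbit p x" if i: "i < d" for i
  proof (rule ccontr)
    assume "orbit p i \<noteq> orbit p x"
    then have "l < card (orbit p i)" using shortest[OF i] by (simp add: l_def)
    also have "orbit p i = (\<lambda>k. (p ^^ k) i) ` {..<l}"
      using orbit_altdef_bounded[OF p_l[OF i] l_pos] by auto
    also have "card \<dots> \<le> l" using card_image_le[of "{..<l}"] by simp
    finally show False by simp
  qed
  then have "{..<d} \<subseteq> orbit p x" using self by blast
  then have "orbit p x = {..<d}" using orbit_sub[OF x] by blast
  then show ?thesis by simp
qed

theorem theorem3p8:
  fixes scaleD :: "'f::field \<Rightarrow> 'd::division_ring \<Rightarrow> 'd"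
    and scaleK :: "'f \<Rightarrow> 'k::field \<Rightarrow> 'k"
    and d :: nat
    and \<phi> :: "'d \<Rightarrow> 'k mat"
    and X :: "'k mat set"
    and p :: "nat \<Rightarrow> nat"
    and z :: 'd
    and g :: "'k mat"
  assumes "central_division_algebra scaleD"
    and "has_degree scaleD d"
    and "d > 2"
    and "splitting_field scaleD scaleK d"
    and "splitting_representation scaleD scaleK d \<phi>"
    and "X \<in> carrier (monomial_group d Mod diagonal_subgroup d)"
    and "coset_permutation d X p"
    and "unique_shortest_cycle d p"
    and "z \<noteq> 0"
    and "g \<in> carrier (GL d)"
  shows "g \<otimes>\<^bsub>GL d\<^esub> \<phi> z \<otimes>\<^bsub>GL d\<^esub> inv\<^bsub>GL d\<^esub> g \<notin> X"
proof
  let ?R = "ring_mat TYPE('k) d ()"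
  define A where "A = g \<otimes>\<^bsub>GL d\<^esub> \<phi> z \<otimes>\<^bsub>GL d\<^esub> inv\<^bsub>GL d\<^esub> g"
  assume "g \<otimes>\<^bsub>GL d\<^esub> \<phi> z \<otimes>\<^bsub>GL d\<^esub> inv\<^bsub>GL d\<^esub> g \<in> X"
  then have AX: "A \<in> X" by (simp add: A_def)
  interpret split_representation scaleD "\<lambda>r. scaleK r 1" d \<phi>
    using assms(1,4,5) by (intro split_representationI) (simp_all add: splitting_field_def)
  interpret R: ring ?R by (rule ring_mat)
  interpret G: group "GL d :: 'k mat monoid" unfolding GL_def by (rule R.units_group)
  have GL_simps: "carrier (GL d) \<subseteq> carrier_mat d d" "x \<otimes>\<^bsub>GL d\<^esub> y = x * y" "\<one>\<^bsub>GL d\<^esub> = 1\<^sub>m d"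
    for x y :: "'k mat"
    by (auto simp: GL_def units_of_def Units_def ring_mat_def)
  define Q where "Q = inv\<^bsub>GL d\<^esub> g"
  have Q: "Q \<in> carrier (GL d)" using assms(10) by (simp add: Q_def)
  have inv: "g * Q = 1\<^sub>m d" "Q * g = 1\<^sub>m d"
    using G.r_inv[OF assms(10)] G.l_inv[OF assms(10)] by (simp_all add: GL_simps(2,3) Q_def)
  have A_eq: "A = g * \<phi> z * Q" by (simp add: A_def GL_simps(2) Q_def)
  have p: "p permutes {..<d}"
    and A_p: "\<And>i j. i < d \<Longrightarrow> j < d \<Longrightarrow> A $$ (i, j) \<noteq> 0 \<longleftrightarrow> i = p j"
    using assms(7) AX by (auto simp: coset_permutation_def)
  define l where "l = Min (card ` perm_cycles d p)"
  have l_d: "l < d" and ex1: "\<exists>!C. C \<in> perm_cycles d p \<and> card C = l"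
    using assms(8) unfolding unique_shortest_cycle_def Let_def l_def by simp_all
  from ex1 obtain C where C: "C \<in> perm_cycles d p" "card C = l"
    and unique: "\<And>C'. C' \<in> perm_cycles d p \<Longrightarrow> card C' = l \<Longrightarrow> C' = C"
    by (elim ex1E) blast
  obtain x where x: "x < d" "C = orbit p x" using C(1) by (auto simp: perm_cycles_def)
  have "card (orbit p x) < card (orbit p i)" if "i < d" "orbit p i \<noteq> orbit p x" for i
  proof -
    have i: "orbit p i \<in> perm_cycles d p" using that by (auto simp: perm_cycles_def)
    then have "l \<le> card (orbit p i)"
      unfolding l_def by (intro Min_le) (auto simp: perm_cycles_def)
    then show ?thesis using unique[OF i] that x C(2) by fastforce
  qed
  note shortest = this
  have "g \<in> carrier_mat d d" "Q \<in> carrier_mat d d" using assms(10) Q GL_simps(1) by auto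
  then have "card (orbit p x) = d"
    using inv p A_p[unfolded A_eq] x(1) shortest by (rule shortest_cycle_is_full[OF assms(2)])
  then show False using l_d C(2) x(2) by simp
qed

end
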